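(* Let $\{(x_n,y_n)\}_{n\in\mathbb N}$ be a sequence generated by the algorithm PDA-C with $\delta\in\,]\frac{\sqrt5-1}{2},1[$, with corresponding sequences $\{z_n\}$ and $\{\lambda_n\}$, and let $(\bar x,\bar y)\in\mathcal S$. Let $N>2$ be an integer such that for all $n>N$ $$\frac{\lambda_n}{\delta\lambda_{n-1}}-\frac{\alpha\lambda_n}{\sqrt\delta\,\lambda_{n+1}}>0,\qquad 1-\frac{\alpha\sqrt\delta\,\lambda_n}{\lambda_{n+1}}>0,\qquad 1-\frac1\delta+\frac{\delta\lambda_{n+1}}{\lambda_n}>0 .$$ For any $n_1>N$ and $j>n_1$ define $$s_j=\sum_{l=n_1}^j\lambda_l,\qquad X_j=\frac{\lambda_{n_1}\delta x_{n_1-1}+\sum_{l=n_1}^j\lambda_lz_l}{\lambda_{n_1}\delta+s_j},\qquad Y_j=\frac{\sum_{l=n_1}^j\lambda_ly_l}{s_j}.$$ Then there exists a sufficiently large $J$ such that for all $j>J$ $$G(X_j,Y_j)=P(X_j)+D(Y_j)\le\frac1{2s_j}\Big[\|x_{n_1}-\bar x\|^2+\frac1\beta\|y_{n_1-1}-\bar y\|^2+2\delta\lambda_{n_1}P(x_{n_1-1})\Big].$$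
   Context: Setting. $X,Y$ are finite-dimensional real inner product spaces with norms $\|\cdot\|=\sqrt{\langle\cdot,\cdot\rangle}$; $K:X\to Y$ is a bounded linear operator with adjoint $K^*$; $f:Y\to(-\infty,+\infty]$ and $g:X\to(-\infty,+\infty]$ are proper lower semicontinuous convex functions; $f^*$ is the Legendre–Fenchel conjugate of $f$. The saddle point problem is $\min_{x\in X}\max_{y\in Y} g(x)+\langle Kx,y\rangle-f^*(y)$; its set of solutions (saddle points) is denoted $\mathcal S$ and is assumed nonempty. A point $(\bar x,\bar y)\in\mathcal S$ satisfies $K\bar x\in\partial f^*(\bar y)$ and $-K^*\bar y\in\partial g(\bar x)$. For a fixed $(\bar x,\bar y)\in\mathcal S$ put $P(x)=g(x)-g(\bar x)+\langle K^*\bar y,x-\bar x\rangle\ge0$ for $x\in X$, $D(y)=f^*(y)-f^*(\bar y)-\langle K\bar x,y-\bar y\rangle\ge0$ for $y\in Y$, and let $G(x,y)=P(x)+D(y)$ be the primal-dual gap. For a proper lsc convex function $h$ and $\lambda>0$, $\mathrm{Prox}_{\lambda h}(x)=\operatorname{argmin}_y\{h(y)+\frac1{2\lambda}\|x-y\|^2\}$. Algorithm PDA-C. Step 0: Take $\delta\in\,]\frac{\sqrt5-1}{2},+\infty[$, $\varrho\in\,]0,1[$, $1<\nu\le\mu$, $x_0\in X$, $y_0\in Y$, $\lambda_0=\lambda_1>0$, $\beta>0$, $\alpha\in\,]0,\frac1{\sqrt\delta}[$. Set $n=0$ and $\zeta_0=\max\{\|x_0-\mathrm{Prox}_{\lambda_0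 g}(x_0-\lambda_0K^*y_0)\|,\ \|y_0-\mathrm{Prox}_{\beta\lambda_0 f^*}(y_0+\beta\lambda_0Kx_0)\|\}$. Step 1: (1.a) Compute $x_{n+1}=\mathrm{Prox}_{\lambda_n g}(x_n-\lambda_nK^*y_n)$. (1.b) Correction, performed only when $\delta<1$: compute $\zeta_{n+1}=\|x_{n+1}-x_n\|$ and check whether $\zeta_{n+1}\le\min\{\mu\zeta_0,\nu\zeta_n\}$; if this does not hold, set $\lambda_n\leftarrow\varrho\lambda_n$, $\lambda_{n+1}\leftarrow\min\{\lambda_n,\lambda_{n+1}\}$ and return to (1.a). Step 2: Compute $z_{n+1}=x_{n+1}+\delta(x_{n+1}-x_n)$ and $y_{n+1}=\mathrm{Prox}_{\beta\lambda_{n+1}f^*}(y_n+\beta\lambda_{n+1}Kz_{n+1})$, and set $\lambda_{n+2}=\min\Big\{\frac{\alpha\|y_{n+1}-y_n\|}{\sqrt\beta\,\|K^*y_{n+1}-K^*y_n\|},\ \lambda_{n+1}\Big\}$ if $K^*y_{n+1}-K^*y_n\ne0$, and $\lambda_{n+2}=\lambda_{n+1}$ otherwise. Step 3: Set $n\leftarrow n+1$ and return to Step 1. In the claim, $\{\lambda_n\}$ denotes the resulting sequence of step sizes (final values, after overwriting by Correction).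
   Formalization: The formal theorem additionally assumes that no Correction is performed in any iteration n > N; without this the claim is false, because a late Correction shrinks λ_n after y_n was computed with the old value. *)

theory Defs
  imports "HOL-Analysis.Analysis"
begin

section \<open>Extended-real-valued convex functions\<close>

definition proper_fun :: "('a \<Rightarrow> ereal) \<Rightarrow> bool"
  where "proper_fun h \<longleftrightarrow> (\<forall>x. h x \<noteq> -\<infinity>) \<and> (\<exists>x. h x \<noteq> \<infinity>)"

definition lsc_fun :: "('a::topological_space \<Rightarrow> ereal) \<Rightarrow> bool"
  where "lsc_fun h \<longleftrightarrow> (\<forall>x. h x \<le> Liminf (at x) h)"

definition convex_fun :: "('a::real_vector \<Rightarrow> ereal) \<Rightarrow> bool"
  where "convex_fun h \<longleftrightarrow> convex {(x, r::real). h x \<le> ereal r}"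

definition conjugate :: "('a::real_inner \<Rightarrow> ereal) \<Rightarrow> 'a \<Rightarrow> ereal"
  where "conjugate h y = (SUP u. ereal (u \<bullet> y) - h u)"

text \<open>For proper, lsc, convex \<open>h\<close> on a Euclidean space and \<open>c > 0\<close> the minimiser exists and is
  unique, so the choice made by \<^const>\<open>arg_min\<close> is immaterial.\<close>

definition prox :: "real \<Rightarrow> ('a::real_inner \<Rightarrow> ereal) \<Rightarrow> 'a \<Rightarrow> 'a"
  where "prox c h x = arg_min (\<lambda>u. h u + ereal (1 / (2 * c) * (norm (x - u))\<^sup>2)) (\<lambda>_. True)"


section \<open>The saddle point problem\<close>

definition lagrangian ::
  "('b::real_inner \<Rightarrow> ereal) \<Rightarrow> ('a \<Rightarrow> ereal) \<Rightarrow> ('a \<Rightarrow> 'b) \<Rightarrow> 'a \<Rightarrow> 'b \<Rightarrow> ereal"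
  where "lagrangian f g K x y = g x + ereal (K x \<bullet> y) - conjugate f y"

text \<open>In \<^typ>\<open>ereal\<close> the undetermined value \<open>\<infinity> - \<infinity>\<close> is \<open>\<infinity>\<close>. This is harmless here: if \<open>f\<close> and \<open>g\<close>
  are proper, lsc and convex, the two inequalities force \<open>g xb\<close> and \<open>conjugate f yb\<close> to be finite,
  and they then say nothing about points outside the effective domains.\<close>

definition saddle_points ::
  "('b::real_inner \<Rightarrow> ereal) \<Rightarrow> ('a \<Rightarrow> ereal) \<Rightarrow> ('a \<Rightarrow> 'b) \<Rightarrow> ('a \<times> 'b) set"
  where "saddle_points f g K = {(xb, yb). \<forall>x y.
    lagrangian f g K xb y \<le> lagrangian f g K xb yb \<and>
    lagrangian f g K xb yb \<le> lagrangian f g K x yb}"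

definition primal_gap ::
  "('a::euclidean_space \<Rightarrow> ereal) \<Rightarrow> ('a \<Rightarrow> 'b::euclidean_space) \<Rightarrow> 'a \<Rightarrow> 'b \<Rightarrow> 'a \<Rightarrow> ereal"
  where "primal_gap g K xb yb x = g x - g xb + ereal (adjoint K yb \<bullet> (x - xb))"

definition dual_gap ::
  "('b::euclidean_space \<Rightarrow> ereal) \<Rightarrow> ('a::euclidean_space \<Rightarrow> 'b) \<Rightarrow> 'a \<Rightarrow> 'b \<Rightarrow> 'b \<Rightarrow> ereal"
  where "dual_gap f K xb yb y = conjugate f y - conjugate f yb - ereal (K xb \<bullet> (y - yb))"

definition pd_gap ::
  "('b::euclidean_space \<Rightarrow> ereal) \<Rightarrow> ('a::euclidean_space \<Rightarrow> ereal) \<Rightarrow> ('a \<Rightarrow> 'b) \<Rightarrow>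
    'a \<Rightarrow> 'b \<Rightarrow> 'a \<Rightarrow> 'b \<Rightarrow> ereal"
  where "pd_gap f g K xb yb x y = primal_gap g K xb yb x + dual_gap f K xb yb y"


section \<open>The algorithm PDA-C\<close>

text \<open>One execution of the overwriting in Correction, acting on the pair
  \<open>(\<lambda>\<^sub>n, \<lambda>\<^sub>n\<^sub>+\<^sub>1)\<close>.\<close>

definition correct :: "real \<Rightarrow> real \<times> real \<Rightarrow> real \<times> real"
  where "correct \<rho> = (\<lambda>(l, l'). (\<rho> * l, min (\<rho> * l) l'))"

text \<open>Correction overwrites step sizes, so one index carries several values over time:
  \<^item> \<open>cur n\<close> is the value of \<open>\<lambda>\<^sub>n\<close>, and \<open>nxt n\<close> that of \<open>\<lambda>\<^sub>n\<^sub>+\<^sub>1\<close>, when iteration \<open>n\<close> starts;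
  \<^item> \<open>k n\<close> is the number of Corrections performed in iteration \<open>n\<close>;
  \<^item> \<open>lam n\<close> is the final value of \<open>\<lambda>\<^sub>n\<close>, and \<open>cur (Suc n)\<close> the value of \<open>\<lambda>\<^sub>n\<^sub>+\<^sub>1\<close>, after them.

  Step 2 of iteration \<open>n\<close> uses the value of \<open>\<lambda>\<^sub>n\<^sub>+\<^sub>1\<close> at that moment, i.e. \<open>cur (Suc n)\<close>, and iteration
  \<open>Suc n\<close> may still overwrite it by the smaller \<open>lam (Suc n)\<close>. In
  particular \<open>y n\<close> was computed with \<open>lam n\<close> only if \<open>k n = 0\<close>. The value \<open>z 0\<close> is never used.\<close>

locale pda_c =
  fixes f :: "'b::euclidean_space \<Rightarrow> ereal"
    and g :: "'a::euclidean_space \<Rightarrow> ereal"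
    and K :: "'a \<Rightarrow> 'b"
    and \<delta> \<rho> \<nu> \<mu> \<beta> \<alpha> :: real
    and x :: "nat \<Rightarrow> 'a" and y :: "nat \<Rightarrow> 'b" and z :: "nat \<Rightarrow> 'a"
    and \<zeta> cur nxt lam :: "nat \<Rightarrow> real"
    and k :: "nat \<Rightarrow> nat"
  fixes trial :: "nat \<Rightarrow> nat \<Rightarrow> real \<times> real"
    and trial_x :: "nat \<Rightarrow> nat \<Rightarrow> 'a"
    and accepted :: "nat \<Rightarrow> nat \<Rightarrow> bool"
  defines "trial \<equiv> \<lambda>n i. (correct \<rho> ^^ i) (cur n, nxt n)"
    and "trial_x \<equiv> \<lambda>n i. prox (fst (trial n i)) g (x n - fst (trial n i) *\<^sub>R adjoint K (y n))"
    and "accepted \<equiv> \<lambda>n i. \<delta> < 1 \<longrightarrow> norm (trial_x n i - x n) \<le> min (\<mu> * \<zeta> 0) (\<nu> * \<zeta> n)"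
  assumes delta: "\<delta> > (sqrt 5 - 1) / 2"
    and rho: "0 < \<rho>" "\<rho> < 1"
    and nu_mu: "1 < \<nu>" "\<nu> \<le> \<mu>"
    and beta: "\<beta> > 0"
    and alpha: "0 < \<alpha>" "\<alpha> < 1 / sqrt \<delta>"
    and init: "cur 0 > 0" "nxt 0 = cur 0"
    and zeta_0: "\<zeta> 0 = max (norm (x 0 - prox (cur 0) g (x 0 - cur 0 *\<^sub>R adjoint K (y 0))))
      (norm (y 0 - prox (\<beta> * cur 0) (conjugate f) (y 0 + (\<beta> * cur 0) *\<^sub>R K (x 0))))"
    and correction: "\<And>n. accepted n (k n)" "\<And>n i. i < k n \<Longrightarrow> \<not> accepted n i"
    and lam_cur: "\<And>n. (lam n, cur (Suc n)) = trial n (k n)"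
    and x_Suc: "\<And>n. x (Suc n) = prox (lam n) g (x n - lam n *\<^sub>R adjoint K (y n))"
    and zeta_Suc: "\<And>n. \<zeta> (Suc n) = norm (x (Suc n) - x n)"
    and z_Suc: "\<And>n. z (Suc n) = x (Suc n) + \<delta> *\<^sub>R (x (Suc n) - x n)"
    and y_Suc: "\<And>n. y (Suc n) =
      prox (\<beta> * cur (Suc n)) (conjugate f) (y n + (\<beta> * cur (Suc n)) *\<^sub>R K (z (Suc n)))"
    and nxt_Suc: "\<And>n. nxt (Suc n) =
      (if adjoint K (y (Suc n)) - adjoint K (y n) \<noteq> 0
       then min (\<alpha> * norm (y (Suc n) - y n)
                 / (sqrt \<beta> * norm (adjoint K (y (Suc n)) - adjoint K (y n)))) (cur (Suc n))
       else cur (Suc n))"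

end

theory Submission
  imports Defs
begin

text \<open>
  Testing the optimality conditions of \<open>x\<^sub>n\<^sub>+\<^sub>1\<close> at \<open>xb\<close>, of \<open>x\<^sub>n\<close> at both \<open>x\<^sub>n\<^sub>+\<^sub>1\<close> and \<open>x\<^sub>n\<^sub>-\<^sub>1\<close>,
  and of \<open>y\<^sub>n\<close> at \<open>yb\<close> gives a one-step inequality which telescopes, except that the squared
  increment \<open>\<parallel>x\<^sub>n\<^sub>+\<^sub>1 - x\<^sub>n\<parallel>\<^sup>2\<close> enters with the negative coefficient \<open>1 - 1/\<delta>\<close> and is compensated only
  by the following step. After summation up to \<open>j\<close>, all increments have positive coefficients but the
  last one. Correction keeps the increments bounded, so the weighted sum of their squares is finite;
  the weights tend to \<open>1 - 1/\<delta> + \<delta> > 0\<close> because the step sizes have a positive limit, hence the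
  increments tend to \<open>0\<close> and for large \<open>j\<close> the last one is absorbed by the sum of the others.
  Jensen's inequality turns the sum of gaps into the gap at the averages.
\<close>

section \<open>Proximal points and conjugates\<close>

lemma lsc_fun_iff_open: "lsc_fun h \<longleftrightarrow> (\<forall>c. open {u. c < h u})"
proof
  assume l: "lsc_fun h"
  show "\<forall>c. open {u. c < h u}"
  proof
    fix c
    have "\<exists>S. open S \<and> v \<in> S \<and> S \<subseteq> {u. c < h u}" if "c < h v" for v
    proof -
      have "h v \<le> Liminf (at v) h" using l by (simp add: lsc_fun_def)
      then have "eventually (\<lambda>u. c < h u) (at v)" using that by (simp add: le_Liminf_iff)
      \<comment> \<open>The \<open>Liminf\<close> runs over punctured neighbourhoods;
        \<open>c < h v\<close> fills in the centre.\<close>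
      then have "eventually (\<lambda>u. c < h u) (nhds v)"
        using that by (auto simp: eventually_at_filter elim: eventually_mono)
      then show ?thesis by (auto simp: eventually_nhds)
    qed
    then show "open {u. c < h u}" by (subst open_subopen) simp
  qed
next
  assume o: "\<forall>c. open {u. c < h u}"
  show "lsc_fun h" unfolding lsc_fun_def le_Liminf_iff
  proof (intro allI impI)
    fix v c assume "c < h v"
    then show "eventually (\<lambda>u. c < h u) (at v)"
      using o by (auto simp: eventually_at_topological intro!: exI[of _ "{u. c < h u}"])
  qed
qed

lemma lsc_fun_add_continuous:
  fixes h :: "'a::topological_space \<Rightarrow> ereal"
  assumes l: "lsc_fun h" and p: "\<forall>u. h u \<noteq> -\<infinity>" and q: "continuous_on UNIV q"
  shows "lsc_fun (\<lambda>u. h u + ereal (q u))"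
  unfolding lsc_fun_iff_open
proof
  fix c :: ereal
  have oh: "open {u. d < h u}" for d using l by (simp add: lsc_fun_iff_open)
  show "open {u. c < h u + ereal (q u)}"
  proof (cases c)
    case (real a)
    \<comment> \<open>A real \<open>r\<close> between \<open>a - q u\<close> and \<open>h u\<close>
      separates the two summands and turns the superlevel set into a union of intersections of open
      sets.\<close>
    have *: "a < h u + ereal (q u) \<longleftrightarrow> (\<exists>r::real. a - r < q u \<and> ereal r < h u)" for u
    proof
      assume "ereal a < h u + ereal (q u)"
      then have "ereal (a - q u) < h u" using p by (cases "h u") auto
      then obtain r where "ereal (a - q u) < ereal r" "ereal r < h u" using ereal_dense2 by blast
      then show "\<exists>r::real. a - r < q u \<and> ereal r < h u" by (intro exI[of _ r]) auto
    next
      assume "\<exists>r::real. a - r < q u \<and> ereal r < h u"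
      then show "ereal a < h u + ereal (q u)" by (cases "h u") auto
    qed
    have "{u. c < h u + ereal (q u)} = (\<Union>r. {u. a - r < q u} \<inter> {u. ereal r < h u})"
      using * real by auto
    also have "open \<dots>"
      by (intro open_UN ballI open_Int oh open_Collect_less continuous_intros q)
    finally show ?thesis .
  next
    case PInf then show ?thesis by simp
  next
    case MInf
    have "{u. c < h u + ereal (q u)} = UNIV"
    proof -
      have "h u + ereal (q u) \<noteq> -\<infinity>" for u using p by (cases "h u") auto
      then show ?thesis using MInf by auto
    qed
    then show ?thesis by simp
  qed
qed

text \<open>Without a minimiser the open sets \<open>{u. h v < h u}\<close> with \<open>v\<close> in
  \<open>S\<close> cover \<open>S\<close>; but among the indices of a finite subcover, one of
  smallest value lies in no member.\<close>

lemma lsc_fun_attains_min: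
  fixes h :: "'a::topological_space \<Rightarrow> ereal"
  assumes l: "lsc_fun h" and S: "compact S" "S \<noteq> {}"
  shows "\<exists>v\<in>S. \<forall>u\<in>S. h v \<le> h u"
proof (rule ccontr)
  assume "\<not> ?thesis"
  then have "S \<subseteq> (\<Union>v\<in>S. {u. h v < h u})" by (auto simp: not_le)
  moreover have "\<forall>v\<in>S. open {u. h v < h u}" using l by (simp add: lsc_fun_iff_open)
  ultimately obtain C where C: "C \<subseteq> S" "finite C" "S \<subseteq> (\<Union>v\<in>C. {u. h v < h u})"
    using compactE_image[OF S(1), of S "\<lambda>v. {u. h v < h u}"] by metis
  then have "C \<noteq> {}" using S by auto
  then have "Min (h ` C) \<in> h ` C" using C by (intro Min_in) auto
  then obtain v where v: "v \<in> C" "h v = Min (h ` C)" by auto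
  then obtain w where "w \<in> C" "h w < h v" using C by blast
  moreover have "h v \<le> h w" using v C \<open>w \<in> C\<close> by auto
  ultimately show False by simp
qed

section \<open>Convexity on the effective domain and lower bounds\<close>

definition eff_dom :: "('a \<Rightarrow> ereal) \<Rightarrow> 'a set"
  where "eff_dom h = {u. h u \<noteq> \<infinity>}"

lemma ereal_real_eff_dom:
  assumes "proper_fun h" "u \<in> eff_dom h"
  shows "h u = ereal (real_of_ereal (h u))"
  using assms by (cases "h u") (auto simp: eff_dom_def proper_fun_def)

text \<open>Averaging two points of the graph inside the convex epigraph bounds \<open>h\<close> at
  the average, which also keeps the average in the effective domain. Later convexity arguments can
  then be carried out in the reals.\<close>

lemma convex_on_eff_dom:
  assumes h: "proper_fun h" "convex_fun h"
  shows "convex_on (eff_dom h) (\<lambda>u. real_of_ereal (h u))"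
proof -
  have *: "h (s *\<^sub>R a + t *\<^sub>R b) \<le> ereal (s * real_of_ereal (h a) + t * real_of_ereal (h b))"
    if "a \<in> eff_dom h" "b \<in> eff_dom h" "0 \<le> s" "0 \<le> t" "s + t = 1" for a b s t
  proof -
    have "(a, real_of_ereal (h a)) \<in> {(x, r::real). h x \<le> ereal r}"
      "(b, real_of_ereal (h b)) \<in> {(x, r::real). h x \<le> ereal r}"
      using ereal_real_eff_dom[OF h(1)] that by auto
    then have "s *\<^sub>R (a, real_of_ereal (h a)) + t *\<^sub>R (b, real_of_ereal (h b))
        \<in> {(x, r::real). h x \<le> ereal r}"
      using h(2) that unfolding convex_fun_def by (intro convexD) auto
    then show ?thesis by simp
  qed
  have dom: "s *\<^sub>R a + t *\<^sub>R b \<in> eff_dom h"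
    if "a \<in> eff_dom h" "b \<in> eff_dom h" "0 \<le> s" "0 \<le> t" "s + t = 1" for a b s t
    using *[OF that] by (auto simp: eff_dom_def)
  show ?thesis
    unfolding convex_on_def
  proof (intro conjI ballI allI impI)
    show "convex (eff_dom h)" using dom by (auto simp: convex_def)
  next
    fix a b s t assume a: "a \<in> eff_dom h" "b \<in> eff_dom h" "0 \<le> s" "0 \<le> t" "s + t = (1::real)"
    show "real_of_ereal (h (s *\<^sub>R a + t *\<^sub>R b)) \<le> s * real_of_ereal (h a) + t * real_of_ereal (h b)"
      using *[OF a] ereal_real_eff_dom[OF h(1) dom[OF a]] by (metis ereal_less_eq(3))
  qed
qed

text \<open>\<open>h\<close> attains its minimum on a unit ball, and convexity along rays propagates this bound; no
  separation theorem is needed.\<close>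

lemma proper_lsc_convex_linear_lower_bound:
  fixes h :: "'a::euclidean_space \<Rightarrow> ereal"
  assumes h: "proper_fun h" "lsc_fun h" "convex_fun h"
  shows "\<exists>a b. \<forall>u. ereal (a - b * norm u) \<le> h u"
proof -
  define r where "r = (\<lambda>u. real_of_ereal (h u))"
  have hr: "h u = ereal (r u)" if "u \<in> eff_dom h" for u
    using ereal_real_eff_dom[OF h(1) that] by (simp add: r_def)
  obtain u0 where u0: "u0 \<in> eff_dom h" using h(1) by (auto simp: proper_fun_def eff_dom_def)
  obtain v where v: "v \<in> cball u0 1" "\<forall>u\<in>cball u0 1. h v \<le> h u"
    using lsc_fun_attains_min[OF h(2) compact_cball, of u0 1] by auto
  have "h v \<le> h u0" using v by simp
  then have vd: "v \<in> eff_dom h" using u0 by (auto simp: eff_dom_def)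
  define m where "m = r v"
  have m: "m \<le> r u" if "u \<in> eff_dom h" "norm (u - u0) \<le> 1" for u
  proof -
    have "h v \<le> h u" using v that by (simp add: dist_norm norm_minus_commute)
    then show ?thesis using hr[OF vd] hr[OF that(1)] by (simp add: m_def)
  qed
  \<comment> \<open>The largest drop below \<open>r u0\<close> on the ball; by convexity, no segment
    from \<open>u0\<close> that leaves the ball descends faster than \<open>e\<close> per unit
    length on average.\<close>
  define e where "e = r u0 - m"
  have e0: "e \<ge> 0" using m[OF u0] by (simp add: e_def)
  have bound: "m - e * norm (u - u0) \<le> r u" if u: "u \<in> eff_dom h" for u
  proof (cases "norm (u - u0) \<le> 1")
    case True
    have "m - e * norm (u - u0) \<le> m" using e0 by simp
    then show ?thesis using m[OF u True] by simp
  next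
    case False
    define R where "R = norm (u - u0)"
    have R: "R > 1" using False by (simp add: R_def)
    \<comment> \<open>This factor puts the convex combination of \<open>u0\<close> and
      \<open>u\<close> on the unit sphere around \<open>u0\<close>, where the lower bound
      \<open>m\<close> is available.\<close>
    define t where "t = 1 / R"
    have t: "0 < t" "t < 1" "t * R = 1" using R by (auto simp: t_def)
    have w: "(1 - t) *\<^sub>R u0 + t *\<^sub>R u \<in> eff_dom h"
      using convex_on_eff_dom[OF h(1,3)] u u0 t unfolding convex_on_def
      by (intro convexD) auto
    have "(1 - t) *\<^sub>R u0 + t *\<^sub>R u - u0 = t *\<^sub>R (u - u0)" by (simp add: algebra_simps)
    then have "norm ((1 - t) *\<^sub>R u0 + t *\<^sub>R u - u0) = 1" using t by (simp add: R_def)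
    then have "m \<le> r ((1 - t) *\<^sub>R u0 + t *\<^sub>R u)" using m[OF w] by simp
    also have "\<dots> \<le> (1 - t) * r u0 + t * r u"
      using convex_on_eff_dom[OF h(1,3)] u u0 t unfolding convex_on_def r_def by auto
    finally have "R * m \<le> R * ((1 - t) * r u0 + t * r u)" using R by simp
    also have "\<dots> = (R - t * R) * r u0 + (t * R) * r u" by (simp add: algebra_simps)
    also have "\<dots> = (R - 1) * r u0 + r u" using t by simp
    finally have "R * m - (R - 1) * r u0 \<le> r u" by simp
    moreover have "R * m - (R - 1) * r u0 = r u0 - e * R" by (simp add: e_def algebra_simps)
    ultimately show ?thesis using e0 by (simp add: R_def e_def)
  qed
  show ?thesis
  proof (intro exI allI)
    fix u
    show "ereal ((m - e * norm u0) - e * norm u) \<le> h u"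
    proof (cases "u \<in> eff_dom h")
      case True
      have "e * norm (u - u0) \<le> e * (norm u + norm u0)"
        using e0 by (intro mult_left_mono norm_triangle_ineq4)
      then show ?thesis using bound[OF True] hr[OF True] by (simp add: algebra_simps)
    qed (simp add: eff_dom_def)
  qed
qed

text \<open>Existence by coercivity: the quadratic term beats the linear minorant, so outside a ball
  the objective is at least its value at a feasible \<open>u0\<close>, and a minimiser over the ball
  is global.\<close>

lemma prox_is_minimizer:
  fixes h :: "'a::euclidean_space \<Rightarrow> ereal"
  assumes h: "proper_fun h" "lsc_fun h" "convex_fun h" and c: "c > 0"
  shows "h (prox c h x) + ereal (1 / (2 * c) * (norm (x - prox c h x))\<^sup>2)
    \<le> h u + ereal (1 / (2 * c) * (norm (x - u))\<^sup>2)"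
proof -
  define F where "F = (\<lambda>u. h u + ereal (1 / (2 * c) * (norm (x - u))\<^sup>2))"
  have lF: "lsc_fun F"
    unfolding F_def using h by (intro lsc_fun_add_continuous continuous_intros) (auto simp: proper_fun_def)
  obtain u0 where u0: "u0 \<in> eff_dom h" using h(1) by (auto simp: proper_fun_def eff_dom_def)
  define M where "M = real_of_ereal (h u0) + 1 / (2 * c) * (norm (x - u0))\<^sup>2"
  have FM: "F u0 = ereal M" using ereal_real_eff_dom[OF h(1) u0] by (simp add: F_def M_def) (metis plus_ereal.simps(1))
  obtain a b where ab: "\<And>u. ereal (a - b * norm u) \<le> h u"
    using proper_lsc_convex_linear_lower_bound[OF h] by blast
  define d where "d = \<bar>b\<bar>"
  \<comment> \<open>With \<open>B\<close> for the absolute value, \<open>t \<ge> R\<close> gives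
    \<open>(d + B) * t \<le> t\<^sup>2 / (2 * c)\<close>: the part \<open>d * t\<close> pays for the
    linear minorant and \<open>B * t\<close> for the constants. The summand
    \<open>norm (x - u0)\<close> keeps \<open>u0\<close> in the ball.\<close>
  define R where "R = 2 * c * (d + \<bar>M - a + d * norm x\<bar>) + 1 + norm (x - u0)"
  have far: "ereal M \<le> F u" if "norm (x - u) \<ge> R" for u
  proof -
    define t where "t = norm (x - u)"
    have dn: "norm u \<le> norm x + t" unfolding t_def by norm
    have "b * norm u \<le> d * norm u" unfolding d_def by (intro mult_right_mono) auto
    also have "\<dots> \<le> d * (norm x + t)" using dn by (intro mult_left_mono) (auto simp: d_def)
    finally have 1: "b * norm u \<le> d * norm x + d * t" by (simp add: algebra_simps)
    define B where "B = \<bar>M - a + d * norm x\<bar>"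
    have B: "B \<ge> 0" "M - a + d * norm x \<le> B" by (auto simp: B_def)
    have d0: "d \<ge> 0" by (simp add: d_def)
    have t: "t \<ge> 2 * c * (d + B) + 1" using that by (simp add: t_def R_def B_def) (smt (verit) norm_ge_zero)
    then have t1: "t \<ge> 1" using c d0 B by (smt (verit) mult_nonneg_nonneg)
    have "(d + B) * t \<le> 1 / (2 * c) * t\<^sup>2"
    proof -
      have "2 * c * (d + B) * t \<le> t * t" using t t1 by (intro mult_right_mono) auto
      then show ?thesis using c by (simp add: field_simps power2_eq_square)
    qed
    moreover have "B * 1 \<le> B * t" using B t1 by (intro mult_left_mono) auto
    ultimately have "M \<le> (a - b * norm u) + 1 / (2 * c) * t\<^sup>2" using 1 B by (simp add: algebra_simps)
    then have "ereal M \<le> ereal (a - b * norm u) + ereal (1 / (2 * c) * t\<^sup>2)" by simp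
    also have "\<dots> \<le> F u" unfolding F_def t_def by (intro add_mono ab) auto
    finally show ?thesis .
  qed
  have R0: "R \<ge> norm (x - u0)" using c by (simp add: R_def d_def)
  then have "R \<ge> 0" by (meson norm_ge_zero order_trans)
  then obtain v where v: "v \<in> cball x R" "\<forall>u\<in>cball x R. F v \<le> F u"
    using lsc_fun_attains_min[OF lF compact_cball, of x R] by auto
  have "F v \<le> F u" for u
  proof (cases "norm (x - u) \<le> R")
    case True then show ?thesis using v by (simp add: dist_norm)
  next
    case False
    have "F v \<le> F u0" using v R0 by (simp add: dist_norm)
    then show ?thesis using far[of u] False FM by (metis linear order_trans)
  qed
  then have "is_arg_min F (\<lambda>_. True) v" by (auto simp: is_arg_min_def not_less)
  then have "is_arg_min F (\<lambda>_. True) (arg_min F (\<lambda>_. True))"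
    unfolding arg_min_def by (rule someI)
  then have "F (arg_min F (\<lambda>_. True)) \<le> F u" by (auto simp: is_arg_min_def not_less)
  then show ?thesis by (simp add: F_def prox_def)
qed

lemma prox_in_eff_dom:
  fixes h :: "'a::euclidean_space \<Rightarrow> ereal"
  assumes h: "proper_fun h" "lsc_fun h" "convex_fun h" and c: "c > 0"
  shows "prox c h x \<in> eff_dom h"
proof -
  obtain u where "h u \<noteq> \<infinity>" using h(1) by (auto simp: proper_fun_def)
  then show ?thesis using prox_is_minimizer[OF h c, of x u] by (auto simp: eff_dom_def)
qed

text \<open>The optimality condition that (x - p)/c is a subgradient of \<open>h\<close> at
  \<open>p\<close>, multiplied by \<open>c\<close>. It comes from comparing \<open>p\<close> with
  points on the segment towards \<open>u\<close>, dividing by the segment parameter and letting it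
  tend to 0.\<close>

lemma prox_inequality:
  fixes h :: "'a::euclidean_space \<Rightarrow> ereal"
  assumes h: "proper_fun h" "lsc_fun h" "convex_fun h" and c: "c > 0"
    and p: "p = prox c h x" and u: "u \<in> eff_dom h"
  shows "c * (real_of_ereal (h p) - real_of_ereal (h u)) \<le> (p - x) \<bullet> (u - p)"
proof -
  define r where "r = (\<lambda>u. real_of_ereal (h u))"
  have hr: "h u = ereal (r u)" if "u \<in> eff_dom h" for u
    using ereal_real_eff_dom[OF h(1) that] by (simp add: r_def)
  note cv = convex_on_eff_dom[OF h(1,3)]
  have pd: "p \<in> eff_dom h" using prox_in_eff_dom[OF h c] p by simp
  have expand: "(norm (a - t *\<^sub>R b))\<^sup>2 = (norm a)\<^sup>2 - 2 * t * (a \<bullet> b) + t\<^sup>2 * (norm b)\<^sup>2" for a b :: 'a and t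
    unfolding power2_norm_eq_inner
    by (simp add: inner_diff_left inner_diff_right inner_commute power2_eq_square right_diff_distrib)
  have ineq: "c * (r p - r u) \<le> (p - x) \<bullet> (u - p) + t * ((norm (u - p))\<^sup>2 / 2)" if t: "0 < t" "t < 1" for t
  proof -
    define w where "w = (1 - t) *\<^sub>R p + t *\<^sub>R u"
    have w: "w \<in> eff_dom h" unfolding w_def
      using cv u pd t unfolding convex_on_def by (intro convexD) auto
    have rw: "r w \<le> (1 - t) * r p + t * r u"
      using cv u pd t unfolding convex_on_def r_def w_def by auto
    have "h p + ereal (1 / (2 * c) * (norm (x - p))\<^sup>2) \<le> h w + ereal (1 / (2 * c) * (norm (x - w))\<^sup>2)"
      unfolding p by (rule prox_is_minimizer[OF h c])
    then have "r p + 1 / (2 * c) * (norm (x - p))\<^sup>2 \<le> r w + 1 / (2 * c) * (norm (x - w))\<^sup>2"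
      using hr[OF w] hr[OF pd] by simp
    then have "2 * c * (r p + 1 / (2 * c) * (norm (x - p))\<^sup>2)
        \<le> 2 * c * (r w + 1 / (2 * c) * (norm (x - w))\<^sup>2)" using c by simp
    then have "2 * c * (r p - r w) + (norm (x - p))\<^sup>2 \<le> (norm (x - w))\<^sup>2"
      using c by (simp add: algebra_simps)
    moreover have "x - w = (x - p) - t *\<^sub>R (u - p)" by (simp add: w_def algebra_simps)
    then have "(norm (x - w))\<^sup>2 = (norm (x - p))\<^sup>2 - 2 * t * ((x - p) \<bullet> (u - p)) + t\<^sup>2 * (norm (u - p))\<^sup>2"
      by (simp only: expand)
    moreover have "2 * c * (t * (r p - r u)) \<le> 2 * c * (r p - r w)" using c rw by (intro mult_left_mono) (auto simp: algebra_simps)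
    ultimately have "2 * t * (c * (r p - r u)) \<le> 2 * t * ((p - x) \<bullet> (u - p)  + t * ((norm (u - p))\<^sup>2 / 2))"
      by (simp add: algebra_simps inner_diff_left power2_eq_square)
    then show ?thesis using t by simp
  qed
  have "((\<lambda>t. (p - x) \<bullet> (u - p) + t * ((norm (u - p))\<^sup>2 / 2)) \<longlongrightarrow>
      (p - x) \<bullet> (u - p) + 0 * ((norm (u - p))\<^sup>2 / 2)) (at_right 0)"
    by (intro tendsto_intros)
  moreover have "\<forall>\<^sub>F t in at_right (0::real). c * (r p - r u) \<le> (p - x) \<bullet> (u - p) + t * ((norm (u - p))\<^sup>2 / 2)"
    using ineq unfolding eventually_at_right_field by (intro exI[of _ 1]) auto
  ultimately show ?thesis
    unfolding r_def[symmetric]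
    by (intro tendsto_lowerbound[where F = "at_right 0", OF _ _ trivial_limit_at_right_real]) (simp_all add: r_def)
qed

section \<open>Conjugates as suprema of affine functions\<close>

lemma lsc_fun_conjugate: "lsc_fun (conjugate f)"
  unfolding lsc_fun_iff_open
proof
  fix c
  have "{y. c < conjugate f y} = (\<Union>u. {y. c < ereal (u \<bullet> y) - f u})"
    by (auto simp: conjugate_def less_SUP_iff)
  also have "open \<dots>"
  proof (intro open_UN ballI)
    fix u show "open {y. c < ereal (u \<bullet> y) - f u}"
    proof (cases "f u")
      case (real r)
      have "open {y. c < ereal (u \<bullet> y - r)}"
        by (intro open_Collect_less continuous_intros)
      then show ?thesis by (simp add: real)
    qed auto
  qed
  finally show "open {y. c < conjugate f y}" .
qed

lemma conjugate_le_iff: "conjugate f y \<le> c \<longleftrightarrow> (\<forall>u. ereal (u \<bullet> y) - f u \<le> c)"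
  by (simp add: conjugate_def SUP_le_iff)

lemma convex_fun_conjugate: "convex_fun (conjugate f)"
proof -
  have "{(y, r::real). conjugate f y \<le> ereal r} = (\<Inter>u. {(y, r::real). ereal (u \<bullet> y) - f u \<le> ereal r})"
    by (auto simp: conjugate_le_iff)
  also have "convex \<dots>"
  proof (intro convex_INT ballI)
    fix u show "convex {(y, r::real). ereal (u \<bullet> y) - f u \<le> ereal r}"
    proof (cases "f u")
      case (real a)
      have "convex {p :: _ \<times> real. (u, -1) \<bullet> p \<le> a}" by (rule convex_halfspace_le)
      also have "{p :: _ \<times> real. (u, -1) \<bullet> p \<le> a} = {(y, r::real). ereal (u \<bullet> y) - f u \<le> ereal r}"
        by (auto simp: real)
      finally show ?thesis .
    qed auto
  qed
  finally show ?thesis by (simp add: convex_fun_def)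
qed

text \<open>The optimality condition of the proximal point \<open>p\<close> of \<open>0\<close> is an affine minorant of \<open>f\<close> with slope \<open>-p\<close>.\<close>

lemma proper_fun_conjugate:
  fixes f :: "'a::euclidean_space \<Rightarrow> ereal"
  assumes f: "proper_fun f" "lsc_fun f" "convex_fun f"
  shows "proper_fun (conjugate f)"
proof -
  obtain u0 where u0: "u0 \<in> eff_dom f" using f(1) by (auto simp: proper_fun_def eff_dom_def)
  have "conjugate f y \<noteq> -\<infinity>" for y
  proof
    assume "conjugate f y = -\<infinity>"
    then have "ereal (u0 \<bullet> y) - f u0 \<le> -\<infinity>" using conjugate_le_iff[of f y "-\<infinity>"] by auto
    then show False by (subst (asm) ereal_real_eff_dom[OF f(1) u0]) simp
  qed
  moreover define p where "p = prox 1 f 0"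
  have "conjugate f (- p) \<le> ereal ((- p) \<bullet> p - real_of_ereal (f p))"
    unfolding conjugate_le_iff
  proof
    fix u show "ereal (u \<bullet> - p) - f u \<le> ereal ((- p) \<bullet> p - real_of_ereal (f p))"
    proof (cases "u \<in> eff_dom f")
      case True
      have "real_of_ereal (f p) - real_of_ereal (f u) \<le> p \<bullet> (u - p)"
        using prox_inequality[OF f _ p_def True] by simp
      then show ?thesis
        by (subst ereal_real_eff_dom[OF f(1) True]) (simp add: inner_diff_right inner_commute)
    qed (simp add: eff_dom_def)
  qed
  then have "conjugate f (- p) \<noteq> \<infinity>" by auto
  ultimately show ?thesis unfolding proper_fun_def by blast
qed

section \<open>Saddle points, averages and the one-step inequality\<close>

text \<open>The order matters: as \<infinity> - \<infinity> is \<infinity>, an infinite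
  \<open>g xb\<close> makes the saddle value \<infinity> whatever \<open>conjugate f yb\<close> is,
  against comparison with a feasible \<open>u0\<close>. Once \<open>g xb\<close> is finite, an
  infinite \<open>conjugate f yb\<close> makes it -\<infinity>, against comparison with a feasible
  \<open>v0\<close>.\<close>

lemma saddle_point_in_eff_dom:
  fixes f :: "'b::euclidean_space \<Rightarrow> ereal" and g :: "'a::real_inner \<Rightarrow> ereal"
  assumes f: "proper_fun (conjugate f)" and g: "proper_fun g"
    and s: "(xb, yb) \<in> saddle_points f g K"
  shows "xb \<in> eff_dom g" "yb \<in> eff_dom (conjugate f)"
proof -
  have s1: "lagrangian f g K xb v \<le> lagrangian f g K xb yb"
    and s2: "lagrangian f g K xb yb \<le> lagrangian f g K u yb" for u v
    using s by (auto simp: saddle_points_def)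
  obtain u0 where u0: "u0 \<in> eff_dom g" using g by (auto simp: proper_fun_def eff_dom_def)
  obtain v0 where v0: "v0 \<in> eff_dom (conjugate f)" using f by (auto simp: proper_fun_def eff_dom_def)
  obtain a where a: "g u0 = ereal a" using ereal_real_eff_dom[OF g u0] by blast
  obtain b where b: "conjugate f v0 = ereal b" using ereal_real_eff_dom[OF f v0] by blast
  have nm: "conjugate f yb \<noteq> -\<infinity>" "g xb \<noteq> -\<infinity>" using f g by (auto simp: proper_fun_def)
  show x: "xb \<in> eff_dom g"
  proof (rule ccontr)
    assume "xb \<notin> eff_dom g"
    then have "lagrangian f g K xb yb = \<infinity>" by (simp add: eff_dom_def lagrangian_def)
    then show False using s2[of u0] nm by (cases "conjugate f yb") (auto simp: lagrangian_def a)
  qed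
  show "yb \<in> eff_dom (conjugate f)"
  proof (rule ccontr)
    assume "yb \<notin> eff_dom (conjugate f)"
    then have "conjugate f yb = \<infinity>" by (simp add: eff_dom_def)
    then show False using s1[of v0] x nm b by (cases "g xb") (auto simp: lagrangian_def eff_dom_def)
  qed
qed

section \<open>Jensen's inequality and Abel summation for weighted averages\<close>

lemma convex_on_weighted_sum:
  fixes F :: "'a::real_vector \<Rightarrow> real"
  assumes F: "convex_on C F" and I: "finite I"
    and w: "\<And>i. i \<in> I \<Longrightarrow> 0 \<le> w i" "sum w I = W" "W > 0"
    and u: "\<And>i. i \<in> I \<Longrightarrow> u i \<in> C"
  shows "(\<Sum>i\<in>I. w i *\<^sub>R u i) /\<^sub>R W \<in> C"
    and "W * F ((\<Sum>i\<in>I. w i *\<^sub>R u i) /\<^sub>R W) \<le> (\<Sum>i\<in>I. w i * F (u i))"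
proof -
  have ne: "I \<noteq> {}" using w by auto
  have e: "(\<Sum>i\<in>I. w i *\<^sub>R u i) /\<^sub>R W = (\<Sum>i\<in>I. (w i / W) *\<^sub>R u i)"
    by (simp add: scaleR_right.sum divide_inverse mult.commute)
  have 1: "(\<Sum>i\<in>I. w i / W) = 1" using w by (simp add: sum_divide_distrib[symmetric])
  show "(\<Sum>i\<in>I. w i *\<^sub>R u i) /\<^sub>R W \<in> C"
    unfolding e using F w u 1 I by (intro convex_sum) (auto simp: convex_on_def)
  have "F (\<Sum>i\<in>I. (w i / W) *\<^sub>R u i) \<le> (\<Sum>i\<in>I. w i / W * F (u i))"
    using w u 1 I ne by (intro convex_on_sum[OF _ _ F]) auto
  also have "\<dots> = (\<Sum>i\<in>I. w i * F (u i)) / W" by (simp add: sum_divide_distrib)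
  finally show "W * F ((\<Sum>i\<in>I. w i *\<^sub>R u i) /\<^sub>R W) \<le> (\<Sum>i\<in>I. w i * F (u i))"
    unfolding e using w by (simp add: field_simps)
qed

text \<open>Abel summation: the extra term cancels the contribution of index \<open>m - 1\<close>.
  For positive decreasing \<open>l\<close> and positive \<open>\<delta>\<close> the new coefficients
  are nonnegative. It is applied to the iterates, to their primal gaps and to the constant
  1.\<close>

lemma extrapolated_sum:
  fixes u :: "nat \<Rightarrow> 'a::real_vector"
  assumes "m \<le> j" "m \<ge> 1"
  shows "(l m * \<delta>) *\<^sub>R u (m - 1) + (\<Sum>i=m..j. l i *\<^sub>R (u i + \<delta> *\<^sub>R (u i - u (i - 1)))) =
    (\<Sum>i=m..j. ((1 + \<delta>) * l i - (if i = j then 0 else \<delta> * l (Suc i))) *\<^sub>R u i)"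
proof -
  \<comment> \<open>The induction uses one uniform coefficient; the surplus
    \<open>\<delta> * l (Suc j)\<close> at the last index is folded in afterwards, whence the case
    \<open>i = j\<close>.\<close>
  have "(l m * \<delta>) *\<^sub>R u (m - 1) + (\<Sum>i=m..j. l i *\<^sub>R (u i + \<delta> *\<^sub>R (u i - u (i - 1)))) =
    (\<Sum>i=m..j. ((1 + \<delta>) * l i - \<delta> * l (Suc i)) *\<^sub>R u i) + (\<delta> * l (Suc j)) *\<^sub>R u j"
    using assms by (induction j rule: dec_induct) (simp_all add: algebra_simps)
  also have "\<dots> = (\<Sum>i=m..j. ((1 + \<delta>) * l i - \<delta> * l (Suc i)) *\<^sub>R u i + (if i = j then (\<delta> * l (Suc j)) *\<^sub>R u j else 0))"
    using assms by (simp add: sum.distrib)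
  also have "\<dots> = (\<Sum>i=m..j. ((1 + \<delta>) * l i - (if i = j then 0 else \<delta> * l (Suc i))) *\<^sub>R u i)"
    by (intro sum.cong) (auto simp: algebra_simps)
  finally show ?thesis .
qed

text \<open>Four optimality conditions are added: that of \<open>x2\<close> at \<open>xb\<close>
  with weight 1, those of \<open>x1\<close> at \<open>x2\<close> and \<open>x0\<close> with weights
  \<open>l1 / l0\<close> and \<open>\<delta> * l1 / l0\<close>, and that of \<open>y1\<close> at
  \<open>yb\<close> with weight \<open>1 / \<beta>\<close>. Function values enter as free reals, so
  only Euclidean algebra and the estimate of one bilinear term remain.\<close>

lemma primal_dual_step:
  fixes K :: "'a::euclidean_space \<Rightarrow> 'b::euclidean_space"
  assumes K: "linear K" and pos: "\<delta> > 0" "\<beta> > 0" "\<alpha> > 0" "l0 > 0" "l1 > 0" "l2 > 0"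
    and z: "z = x1 + \<delta> *\<^sub>R (x1 - x0)"
    and xb: "l1 * (g2 - gb) \<le> (x2 - (x1 - l1 *\<^sub>R adjoint K y1)) \<bullet> (xb - x2)"
    and x2: "l0 * (g1 - g2) \<le> (x1 - (x0 - l0 *\<^sub>R adjoint K y0)) \<bullet> (x2 - x1)"
    and x0: "l0 * (g1 - g0) \<le> (x1 - (x0 - l0 *\<^sub>R adjoint K y0)) \<bullet> (x0 - x1)"
    and yb: "(\<beta> * l1) * (f1 - fb) \<le> (y1 - (y0 + (\<beta> * l1) *\<^sub>R K z)) \<bullet> (yb - y1)"
    and step: "sqrt \<beta> * l2 * norm (adjoint K y1 - adjoint K y0) \<le> \<alpha> * norm (y1 - y0)"
  defines "p \<equiv> \<lambda>v gv. gv - gb + adjoint K yb \<bullet> (v - xb)"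
    and "d \<equiv> f1 - fb - K xb \<bullet> (y1 - yb)"
  shows "2 * l1 * ((1 + \<delta>) * p x1 g1 - \<delta> * p x0 g0 + d)
      + (1 - l1 / (\<delta> * l0)) * (norm (x2 - x1))\<^sup>2 + \<delta> * l1 / l0 * (norm (x1 - x0))\<^sup>2
      + (l1 / (\<delta> * l0) - \<alpha> * l1 / (sqrt \<delta> * l2)) * (norm (x2 - z))\<^sup>2
      + 1 / \<beta> * (1 - \<alpha> * sqrt \<delta> * l1 / l2) * (norm (y1 - y0))\<^sup>2
      + (norm (x2 - xb))\<^sup>2 + 1 / \<beta> * (norm (y1 - yb))\<^sup>2
    \<le> (norm (x1 - xb))\<^sup>2 + 1 / \<beta> * (norm (y0 - yb))\<^sup>2"
proof -
  define \<theta> where "\<theta> = l1 / (\<delta> * l0)"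
  have adj: "adjoint K v \<bullet> u = K u \<bullet> v" for u v
    using adjoint_works[OF K, of u v] by (simp add: inner_commute)
  have polar: "2 * ((a - b) \<bullet> (c - a)) = (norm (b - c))\<^sup>2 - (norm (a - c))\<^sup>2 - (norm (a - b))\<^sup>2"
    for a b c :: "'c::real_inner"
    unfolding power2_norm_eq_inner by (simp add: inner_diff_left inner_diff_right inner_commute)
  have "l0 * ((1 + \<delta>) * g1 - g2 - \<delta> * g0)
      \<le> (x1 - x0 + l0 *\<^sub>R adjoint K y0) \<bullet> ((x2 - x1) + \<delta> *\<^sub>R (x0 - x1))"
  proof -
    have "\<delta> * (l0 * (g1 - g0)) \<le> \<delta> * ((x1 - (x0 - l0 *\<^sub>R adjoint K y0)) \<bullet> (x0 - x1))"
      using x0 pos by simp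
    then show ?thesis using x2 by (simp add: inner_add_right algebra_simps)
  qed
  \<comment> \<open>Both vectors are expressed through \<open>z\<close>; the three-point identity
    then yields a negative multiple of \<open>(norm (x2 - z))\<^sup>2\<close>, available against the
    coupling error.\<close>
  also have "(x2 - x1) + \<delta> *\<^sub>R (x0 - x1) = x2 - z" by (simp add: z algebra_simps)
  also have "x1 - x0 = (1 / \<delta>) *\<^sub>R (z - x1)" using pos by (simp add: z)
  finally have "l1 / l0 * (l0 * ((1 + \<delta>) * g1 - g2 - \<delta> * g0))
      \<le> l1 / l0 * (((1 / \<delta>) *\<^sub>R (z - x1) + l0 *\<^sub>R adjoint K y0) \<bullet> (x2 - z))"
    using pos by (intro mult_left_mono) auto
  also have "\<dots> = \<theta> * ((z - x1) \<bullet> (x2 - z)) + l1 * (adjoint K y0 \<bullet> (x2 - z))"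
    using pos by (simp only: inner_add_left inner_scaleR_left \<theta>_def) (simp add: field_simps)
  finally have G: "l1 * ((1 + \<delta>) * g1 - g2 - \<delta> * g0)
      \<le> \<theta> * ((z - x1) \<bullet> (x2 - z)) + l1 * (adjoint K y0 \<bullet> (x2 - z))"
    using pos by simp
  have "1 / \<beta> * ((\<beta> * l1) * (f1 - fb)) \<le> 1 / \<beta> * ((y1 - (y0 + (\<beta> * l1) *\<^sub>R K z)) \<bullet> (yb - y1))"
    using yb pos by (intro mult_left_mono) auto
  also have "\<dots> = 1 / \<beta> * ((y1 - y0) \<bullet> (yb - y1)) - l1 * (K z \<bullet> (yb - y1))"
  proof -
    have "(y1 - (y0 + (\<beta> * l1) *\<^sub>R K z)) \<bullet> (yb - y1)
        = (y1 - y0) \<bullet> (yb - y1) - \<beta> * l1 * (K z \<bullet> (yb - y1))"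
      by (simp add: inner_diff_left inner_add_left)
    then show ?thesis using pos by (simp add: field_simps)
  qed
  finally have F: "l1 * (f1 - fb) \<le> 1 / \<beta> * ((y1 - y0) \<bullet> (yb - y1)) - l1 * (K z \<bullet> (yb - y1))"
    using pos by simp
  have X: "l1 * (g2 - gb) \<le> (x2 - x1) \<bullet> (xb - x2) + l1 * (adjoint K y1 \<bullet> (xb - x2))"
    using xb by (simp add: inner_add_left inner_diff_left)
  \<comment> \<open>Every bilinear term is either part of the gap or contains the increment of
    \<open>adjoint K\<close> that the step size rule controls.\<close>
  have bil: "adjoint K y0 \<bullet> (x2 - z) - K z \<bullet> (yb - y1) + adjoint K y1 \<bullet> (xb - x2)
      = (adjoint K y1 - adjoint K y0) \<bullet> (z - x2) + K xb \<bullet> y1 - K z \<bullet> yb"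
    by (simp add: adj inner_diff_left inner_diff_right)
  have Kz: "K z = K x1 + \<delta> *\<^sub>R (K x1 - K x0)"
    by (simp add: z linear_add[OF K] linear_diff[OF K] linear_cmul[OF K])
  have gap: "(1 + \<delta>) * p x1 g1 - \<delta> * p x0 g0 + d
      = (1 + \<delta>) * g1 - \<delta> * g0 - gb + (f1 - fb) + K z \<bullet> yb - K xb \<bullet> y1"
    unfolding p_def d_def Kz adj
    by (simp add: linear_diff[OF K] inner_diff_left inner_diff_right inner_add_left algebra_simps)
  have "l1 * ((1 + \<delta>) * g1 - \<delta> * g0 - gb + (f1 - fb))
      \<le> (x2 - x1) \<bullet> (xb - x2) + \<theta> * ((z - x1) \<bullet> (x2 - z)) + 1 / \<beta> * ((y1 - y0) \<bullet> (yb - y1))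
        + l1 * (adjoint K y0 \<bullet> (x2 - z) - K z \<bullet> (yb - y1) + adjoint K y1 \<bullet> (xb - x2))"
    using G F X by (simp add: algebra_simps)
  then have main: "l1 * ((1 + \<delta>) * p x1 g1 - \<delta> * p x0 g0 + d)
      \<le> (x2 - x1) \<bullet> (xb - x2) + \<theta> * ((z - x1) \<bullet> (x2 - z)) + 1 / \<beta> * ((y1 - y0) \<bullet> (yb - y1))
        + l1 * ((adjoint K y1 - adjoint K y0) \<bullet> (z - x2))"
    unfolding gap bil by (simp add: algebra_simps)
  define a b where "a = norm (y1 - y0)" and "b = norm (x2 - z)"
  have "2 * (l1 * ((adjoint K y1 - adjoint K y0) \<bullet> (z - x2)))
      \<le> 2 * l1 * (norm (adjoint K y1 - adjoint K y0) * b)"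
    using norm_cauchy_schwarz[of "adjoint K y1 - adjoint K y0" "z - x2"] pos
    by (simp add: b_def norm_minus_commute)
  also have "\<dots> \<le> 2 * l1 * (\<alpha> * a / (sqrt \<beta> * l2) * b)"
    using step pos by (intro mult_left_mono mult_right_mono) (auto simp: a_def b_def field_simps)
  also have "\<dots> = \<alpha> * l1 / l2 * (2 * (a / sqrt \<beta> * b))" using pos by (simp add: field_simps)
  \<comment> \<open>Young's inequality, balanced by \<open>sqrt \<delta>\<close> so as to give the
    two \<open>\<alpha>\<close>-terms in the coefficients of the claim.\<close>
  also have "\<dots> \<le> \<alpha> * l1 / l2 * (sqrt \<delta> / \<beta> * a\<^sup>2 + 1 / sqrt \<delta> * b\<^sup>2)"
  proof (intro mult_left_mono)
    have r: "(sqrt (sqrt \<delta>))\<^sup>2 = sqrt \<delta>" "(sqrt \<beta>)\<^sup>2 = \<beta>" "sqrt (sqrt \<delta>) > 0" using pos by auto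
    have "0 \<le> (sqrt (sqrt \<delta>) * (a / sqrt \<beta>) - b / sqrt (sqrt \<delta>))\<^sup>2" by simp
    also have "\<dots> = (sqrt (sqrt \<delta>))\<^sup>2 * a\<^sup>2 / (sqrt \<beta>)\<^sup>2 + b\<^sup>2 / (sqrt (sqrt \<delta>))\<^sup>2 - 2 * (a / sqrt \<beta> * b)"
      unfolding power2_diff power_mult_distrib power_divide using r(3) by simp
    finally show "2 * (a / sqrt \<beta> * b) \<le> sqrt \<delta> / \<beta> * a\<^sup>2 + 1 / sqrt \<delta> * b\<^sup>2"
      unfolding r(1,2) by simp
  qed (use pos in auto)
  also have "\<dots> = \<alpha> * l1 / (sqrt \<delta> * l2) * b\<^sup>2 + 1 / \<beta> * (\<alpha> * sqrt \<delta> * l1 / l2) * a\<^sup>2"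
    using pos by (simp add: field_simps)
  finally have cs: "2 * (l1 * ((adjoint K y1 - adjoint K y0) \<bullet> (z - x2)))
      \<le> \<alpha> * l1 / (sqrt \<delta> * l2) * b\<^sup>2 + 1 / \<beta> * (\<alpha> * sqrt \<delta> * l1 / l2) * a\<^sup>2" .
  have 1: "2 * ((x2 - x1) \<bullet> (xb - x2)) = (norm (x1 - xb))\<^sup>2 - (norm (x2 - xb))\<^sup>2 - (norm (x2 - x1))\<^sup>2"
    by (rule polar)
  have "2 * ((z - x1) \<bullet> (x2 - z)) = (norm (x2 - x1))\<^sup>2 - b\<^sup>2 - \<delta>\<^sup>2 * (norm (x1 - x0))\<^sup>2"
    using polar[of z x1 x2] by (simp add: b_def norm_minus_commute) (simp add: z power_mult_distrib norm_minus_commute)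
  then have "\<theta> * (2 * ((z - x1) \<bullet> (x2 - z))) = \<theta> * ((norm (x2 - x1))\<^sup>2 - b\<^sup>2 - \<delta>\<^sup>2 * (norm (x1 - x0))\<^sup>2)"
    by simp
  also have "\<dots> = \<theta> * (norm (x2 - x1))\<^sup>2 - \<theta> * b\<^sup>2 - \<delta> * l1 / l0 * (norm (x1 - x0))\<^sup>2"
    using pos by (simp add: \<theta>_def field_simps power2_eq_square)
  finally have 2: "2 * (\<theta> * ((z - x1) \<bullet> (x2 - z)))
      = \<theta> * (norm (x2 - x1))\<^sup>2 - \<theta> * b\<^sup>2 - \<delta> * l1 / l0 * (norm (x1 - x0))\<^sup>2" by simp
  have "1 / \<beta> * (2 * ((y1 - y0) \<bullet> (yb - y1))) = 1 / \<beta> * ((norm (y0 - yb))\<^sup>2 - (norm (y1 - yb))\<^sup>2 - a\<^sup>2)"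
    unfolding polar a_def by simp
  then have 3: "2 * (1 / \<beta> * ((y1 - y0) \<bullet> (yb - y1)))
      = 1 / \<beta> * (norm (y0 - yb))\<^sup>2 - 1 / \<beta> * (norm (y1 - yb))\<^sup>2 - 1 / \<beta> * a\<^sup>2"
    by (simp add: right_diff_distrib diff_divide_distrib)
  have rearrange: "2 * l1 * Q + (1 - \<theta>) * A + B + (\<theta> - C) * b\<^sup>2 + 1 / \<beta> * (1 - E) * a\<^sup>2 + V2 + W1 \<le> V1 + W0"
    if "l1 * Q \<le> i + j + m + n" "2 * i = V1 - V2 - A" "2 * j = \<theta> * A - \<theta> * b\<^sup>2 - B"
      "2 * m = W0 - W1 - 1 / \<beta> * a\<^sup>2" "2 * n \<le> C * b\<^sup>2 + 1 / \<beta> * E * a\<^sup>2"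
    for Q A B C E V1 V2 W0 W1 i j m n
    using that by (simp add: algebra_simps diff_divide_distrib)
  show ?thesis
    using rearrange[OF main 1 2 3 cs] by (simp only: \<theta>_def a_def b_def)
qed

section \<open>Step sizes\<close>

context pda_c
begin

lemma fst_trial: "fst (trial n i) = \<rho> ^ i * cur n"
  by (induction i) (auto simp: trial_def correct_def case_prod_beta)

lemma snd_trial_le: "snd (trial n i) \<le> nxt n"
  by (induction i) (auto simp: trial_def correct_def case_prod_beta)

lemma snd_trial_le_fst: "nxt n \<le> cur n \<Longrightarrow> snd (trial n i) \<le> fst (trial n i)"
  by (induction i) (auto simp: trial_def correct_def case_prod_beta)

lemma snd_trial_pos: "0 < cur n \<Longrightarrow> 0 < nxt n \<Longrightarrow> 0 < snd (trial n i)"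
proof (induction i)
  case 0 then show ?case by (simp add: trial_def)
next
  case (Suc i)
  have "snd (trial n (Suc i)) = min (\<rho> * fst (trial n i)) (snd (trial n i))"
    by (simp add: trial_def correct_def case_prod_beta)
  then show ?case using Suc rho by (simp add: fst_trial)
qed

lemma lam_eq: "lam n = \<rho> ^ k n * cur n" and cur_Suc: "cur (Suc n) = snd (trial n (k n))"
  using lam_cur[of n] fst_trial[of n "k n"] by (metis fst_conv, metis snd_conv)

lemma cur_nxt_bounds: "0 < cur n \<and> 0 < nxt n \<and> nxt n \<le> cur n"
proof (induction n)
  case 0 then show ?case using init by simp
next
  case (Suc n)
  have "0 < cur (Suc n)" using Suc snd_trial_pos by (simp add: cur_Suc)
  moreover have "0 < norm (y (Suc n) - y n)" if "adjoint K (y (Suc n)) - adjoint K (y n) \<noteq> 0"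
    using that by auto
  ultimately show ?case using alpha beta by (simp add: nxt_Suc)
qed

lemma lam_pos: "0 < lam n"
  using cur_nxt_bounds[of n] rho by (simp add: lam_eq)

lemma cur_Suc_le_lam: "cur (Suc n) \<le> lam n"
  using snd_trial_le_fst[of n "k n"] cur_nxt_bounds[of n] by (simp add: fst_trial lam_eq cur_Suc)

lemma lam_le_cur: "lam n \<le> cur n"
  using cur_nxt_bounds[of n] rho by (simp add: lam_eq power_le_one mult_left_le_one_le)

lemma decseq_lam: "decseq lam"
  unfolding decseq_Suc_iff using lam_le_cur cur_Suc_le_lam by (meson order_trans)

lemma lam_uncorrected: "k n = 0 \<Longrightarrow> lam n = cur n" "k n = 0 \<Longrightarrow> cur (Suc n) = nxt n"
  by (simp_all add: lam_eq cur_Suc trial_def)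

text \<open>Corrections only lower step sizes, so the ratio entering \<open>nxt (Suc n)\<close>
  still bounds the final \<open>lam (Suc (Suc n))\<close>.\<close>

lemma lam_step_bound:
  "sqrt \<beta> * lam (Suc (Suc n)) * norm (adjoint K (y (Suc n)) - adjoint K (y n)) \<le> \<alpha> * norm (y (Suc n) - y n)"
proof (cases "adjoint K (y (Suc n)) - adjoint K (y n) = 0")
  case True then show ?thesis using alpha by simp
next
  case False
  have "lam (Suc (Suc n)) \<le> nxt (Suc n)"
    using lam_le_cur[of "Suc (Suc n)"] snd_trial_le[of "Suc n"] cur_Suc[of "Suc n"] by (metis order_trans)
  also have "\<dots> \<le> \<alpha> * norm (y (Suc n) - y n)
                 / (sqrt \<beta> * norm (adjoint K (y (Suc n)) - adjoint K (y n)))"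
    using False by (simp add: nxt_Suc)
  finally show ?thesis using False beta by (simp add: field_simps)
qed

text \<open>The accepted trial point is \<open>x (Suc n)\<close>, and for
  \<open>\<delta> < 1\<close> acceptance includes the comparison with
  \<open>\<mu> * \<zeta> 0\<close>.\<close>

lemma increment_bounded: "\<delta> < 1 \<Longrightarrow> norm (x (Suc n) - x n) \<le> \<mu> * \<zeta> 0"
  using correction(1)[of n] lam_eq[of n]
  by (simp add: accepted_def trial_x_def x_Suc fst_trial)

text \<open>Once Corrections have stopped, a new step size is the old one or a ratio of at least
  \<open>\<alpha> / (sqrt \<beta> * L)\<close>, where \<open>L\<close> bounds the adjoint. So the
  decreasing sequence stays above a positive number.\<close>

lemma lam_limit_pos:
  assumes K: "bounded_linear K" and k: "\<And>n. n > N \<Longrightarrow> k n = 0"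
  shows "\<exists>l>0. lam \<longlonglongrightarrow> l"
proof -
  have "bounded_linear (adjoint K)"
    using K by (simp add: adjoint_linear bounded_linear.linear linear_conv_bounded_linear[symmetric])
  then obtain L where L: "L > 0" "\<And>w. norm (adjoint K w) \<le> norm w * L"
    using bounded_linear.pos_bounded by metis
  have lin: "adjoint K (a - b) = adjoint K a - adjoint K b" for a b
    using K by (simp add: adjoint_linear bounded_linear.linear linear_diff)
  define l0 where "l0 = min (\<alpha> / (sqrt \<beta> * L)) (lam (Suc N))"
  have l0: "l0 > 0" using alpha beta L lam_pos by (simp add: l0_def)
  have low: "l0 \<le> lam (Suc N + i)" for i
  proof (induction i)
    case 0 then show ?case by (simp add: l0_def)
  next
    case (Suc i)
    define n where "n = N + i"
    \<comment> \<open>The proposal \<open>nxt (Suc n)\<close> becomes final because neither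
      iteration \<open>Suc n\<close> nor the following one corrects.\<close>
    have e: "lam (Suc (Suc n)) = nxt (Suc n)" "lam (Suc n) = cur (Suc n)"
      using k[of "Suc n"] k[of "Suc (Suc n)"] lam_uncorrected by (auto simp: n_def)
    have "\<alpha> / (sqrt \<beta> * L) \<le> \<alpha> * norm (y (Suc n) - y n)
                 / (sqrt \<beta> * norm (adjoint K (y (Suc n)) - adjoint K (y n)))"
      if "adjoint K (y (Suc n)) - adjoint K (y n) \<noteq> 0"
    proof -
      have "norm (adjoint K (y (Suc n)) - adjoint K (y n)) \<le> norm (y (Suc n) - y n) * L"
        using L(2)[of "y (Suc n) - y n"] by (simp add: lin)
      then show ?thesis using that L alpha beta by (simp add: field_simps)
    qed
    then have "min (\<alpha> / (sqrt \<beta> * L)) (cur (Suc n)) \<le> nxt (Suc n)" by (auto simp: nxt_Suc)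
    moreover have "l0 \<le> cur (Suc n)" using Suc e by (simp add: n_def)
    ultimately show ?case using e by (auto simp: n_def l0_def)
  qed
  have "\<forall>n. 0 \<le> lam n" using lam_pos less_imp_le by blast
  then obtain l where l: "lam \<longlonglongrightarrow> l" using decseq_lam decseq_convergent[of lam 0] by metis
  have "\<forall>n\<ge>Suc N. l0 \<le> lam n" using low by (metis le_add_diff_inverse)
  then have "l0 \<le> l" using LIMSEQ_le_const[OF l] by blast
  then show ?thesis using l l0 by (intro exI[of _ l]) auto
qed

end

section \<open>The ergodic gap estimate\<close>

text \<open>\<open>no_late_correction\<close> is assumed besides the three coefficient conditions.
  For \<open>n > N\<close> it identifies \<open>cur n\<close> with \<open>lam n\<close>, so that
  \<open>y n\<close> and \<open>x (Suc n)\<close> use the same step size, and it gives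
  \<open>lam\<close> a positive limit.\<close>

locale pda_c_saddle = pda_c +
  fixes xb and yb and N :: nat
  assumes f: "proper_fun f" "lsc_fun f" "convex_fun f"
    and g: "proper_fun g" "lsc_fun g" "convex_fun g"
    and bl: "bounded_linear K"
    and delta_lt_1: "\<delta> < 1"
    and saddle: "(xb, yb) \<in> saddle_points f g K"
    and primal_coeff: "\<And>n. n > N \<Longrightarrow> lam n / (\<delta> * lam (n - 1)) - \<alpha> * lam n / (sqrt \<delta> * lam (n + 1)) > 0"
    and dual_coeff: "\<And>n. n > N \<Longrightarrow> 1 - \<alpha> * sqrt \<delta> * lam n / lam (n + 1) > 0"
    and increment_coeff: "\<And>n. n > N \<Longrightarrow> 1 - 1 / \<delta> + \<delta> * lam (n + 1) / lam n > 0"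
    and no_late_correction: "\<And>n. n > N \<Longrightarrow> k n = 0"
begin

text \<open>Real-valued gaps, here and in \<open>D\<close>. They agree with the extended ones only
  on the effective domains, since \<open>real_of_ereal\<close> sends \<infinity> to 0.\<close>

definition "P u = real_of_ereal (g u) - real_of_ereal (g xb) + adjoint K yb \<bullet> (u - xb)"

definition "D v = real_of_ereal (conjugate f v) - real_of_ereal (conjugate f yb) - K xb \<bullet> (v - yb)"

definition increment :: "nat \<Rightarrow> real"
  where "increment n = (norm (x (Suc n) - x n))\<^sup>2"

text \<open>The one-step inequality at \<open>n\<close> contributes \<open>1 - 1 / \<delta>\<close>,
  which is negative, and the one at \<open>Suc n\<close> the ratio term.\<close>

definition coeff :: "nat \<Rightarrow> real"
  where "coeff n = 1 - 1 / \<delta> + \<delta> * lam (Suc n) / lam n"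

definition gap_term :: "nat \<Rightarrow> real"
  where "gap_term n = lam n * ((1 + \<delta>) * P (x n) - \<delta> * P (x (n - 1)) + D (y n))"

section \<open>Finiteness, sign and convexity of the gaps\<close>

lemma linear_K: "linear K"
  using bl by (rule bounded_linear.linear)

lemma delta_pos: "\<delta> > 0"
proof -
  have "0 < (sqrt 5 - 1) / 2" by (simp add: real_less_rsqrt)
  then show ?thesis using delta by (rule less_trans)
qed

lemma conjugate_f: "proper_fun (conjugate f)" "lsc_fun (conjugate f)" "convex_fun (conjugate f)"
  using proper_fun_conjugate[OF f] lsc_fun_conjugate convex_fun_conjugate by auto

lemma saddle_in_eff_dom: "xb \<in> eff_dom g" "yb \<in> eff_dom (conjugate f)"
  using saddle_point_in_eff_dom[OF conjugate_f(1) g(1) saddle] by auto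

lemma adjoint_inner: "adjoint K v \<bullet> u = K u \<bullet> v"
  using adjoint_works[OF linear_K, of u v] by (simp add: inner_commute)

lemma primal_gap_eq:
  assumes "u \<in> eff_dom g" shows "primal_gap g K xb yb u = ereal (P u)"
  unfolding primal_gap_def P_def
  by (subst ereal_real_eff_dom[OF g(1) assms], subst ereal_real_eff_dom[OF g(1) saddle_in_eff_dom(1)]) simp

lemma dual_gap_eq:
  assumes "v \<in> eff_dom (conjugate f)" shows "dual_gap f K xb yb v = ereal (D v)"
  unfolding dual_gap_def D_def
  by (subst ereal_real_eff_dom[OF conjugate_f(1) assms], subst ereal_real_eff_dom[OF conjugate_f(1) saddle_in_eff_dom(2)]) simp

lemma P_nonneg: assumes u: "u \<in> eff_dom g" shows "0 \<le> P u"
proof -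
  have "lagrangian f g K xb yb \<le> lagrangian f g K u yb" using saddle by (auto simp: saddle_points_def)
  then have "real_of_ereal (g xb) + K xb \<bullet> yb \<le> real_of_ereal (g u) + K u \<bullet> yb"
    unfolding lagrangian_def
    by (subst (asm) ereal_real_eff_dom[OF g(1) u], subst (asm) ereal_real_eff_dom[OF g(1) saddle_in_eff_dom(1)],
        subst (asm) (1 2) ereal_real_eff_dom[OF conjugate_f(1) saddle_in_eff_dom(2)]) simp
  then show ?thesis by (simp add: P_def inner_diff_right adjoint_inner)
qed

lemma D_nonneg: assumes v: "v \<in> eff_dom (conjugate f)" shows "0 \<le> D v"
proof -
  have "lagrangian f g K xb v \<le> lagrangian f g K xb yb" using saddle by (auto simp: saddle_points_def)
  then have "K xb \<bullet> v - real_of_ereal (conjugate f v) \<le> K xb \<bullet> yb - real_of_ereal (conjugate f yb)"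
    unfolding lagrangian_def
    by (subst (asm) ereal_real_eff_dom[OF conjugate_f(1) v], subst (asm) (1 2) ereal_real_eff_dom[OF g(1) saddle_in_eff_dom(1)],
        subst (asm) ereal_real_eff_dom[OF conjugate_f(1) saddle_in_eff_dom(2)]) simp
  then show ?thesis by (simp add: D_def inner_diff_right)
qed

lemma convex_on_P: "convex_on (eff_dom g) P"
proof -
  have "convex_on (eff_dom g) (\<lambda>u. real_of_ereal (g u) + (adjoint K yb \<bullet> (u - xb) - real_of_ereal (g xb)))"
    using convex_on_eff_dom[OF g(1,3)]
  proof (rule convex_on_add)
    have c: "convex (eff_dom g)" using convex_on_eff_dom[OF g(1,3)] by (simp add: convex_on_def)
    show "convex_on (eff_dom g) (\<lambda>u. adjoint K yb \<bullet> (u - xb) - real_of_ereal (g xb))"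
      unfolding convex_on_def using c
    proof (intro conjI ballI allI impI)
      fix a b and s t :: real assume "s + t = 1"
      then have s: "s = 1 - t" by simp
      show "adjoint K yb \<bullet> (s *\<^sub>R a + t *\<^sub>R b - xb) - real_of_ereal (g xb)
        \<le> s * (adjoint K yb \<bullet> (a - xb) - real_of_ereal (g xb)) + t * (adjoint K yb \<bullet> (b - xb) - real_of_ereal (g xb))"
        unfolding s by (simp add: inner_diff_right inner_add_right algebra_simps)
    qed
  qed
  moreover have "P = (\<lambda>u. real_of_ereal (g u) + (adjoint K yb \<bullet> (u - xb) - real_of_ereal (g xb)))"
    by (auto simp: P_def)
  ultimately show ?thesis by simp
qed

lemma convex_on_D: "convex_on (eff_dom (conjugate f)) D"
proof -
  have "convex_on (eff_dom (conjugate f)) (\<lambda>v. real_of_ereal (conjugate f v) + (- (K xb \<bullet> (v - yb)) - real_of_ereal (conjugate f yb)))"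
    using convex_on_eff_dom[OF conjugate_f(1,3)]
  proof (rule convex_on_add)
    have c: "convex (eff_dom (conjugate f))" using convex_on_eff_dom[OF conjugate_f(1,3)] by (simp add: convex_on_def)
    show "convex_on (eff_dom (conjugate f)) (\<lambda>v. - (K xb \<bullet> (v - yb)) - real_of_ereal (conjugate f yb))"
      unfolding convex_on_def using c
    proof (intro conjI ballI allI impI)
      fix a b and s t :: real assume "s + t = 1"
      then have s: "s = 1 - t" by simp
      show "- (K xb \<bullet> (s *\<^sub>R a + t *\<^sub>R b - yb)) - real_of_ereal (conjugate f yb)
        \<le> s * (- (K xb \<bullet> (a - yb)) - real_of_ereal (conjugate f yb)) + t * (- (K xb \<bullet> (b - yb)) - real_of_ereal (conjugate f yb))"
        unfolding s by (simp add: inner_diff_right inner_add_right algebra_simps)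
    qed
  qed
  moreover have "D = (\<lambda>v. real_of_ereal (conjugate f v) + (- (K xb \<bullet> (v - yb)) - real_of_ereal (conjugate f yb)))"
    by (auto simp: D_def)
  ultimately show ?thesis by simp
qed

lemma cur_pos: "0 < cur n"
  using cur_nxt_bounds by blast

text \<open>Index 0 is excluded because \<open>x 0\<close> is arbitrary, while later iterates are
  proximal points.\<close>

lemma x_in_eff_dom: "n > 0 \<Longrightarrow> x n \<in> eff_dom g"
  using x_Suc[of "n - 1"] prox_in_eff_dom[OF g lam_pos] by simp

lemma y_in_eff_dom: "n > 0 \<Longrightarrow> y n \<in> eff_dom (conjugate f)"
  using y_Suc[of "n - 1"] prox_in_eff_dom[OF conjugate_f, of "\<beta> * cur n"] beta cur_pos by simp

text \<open>\<open>primal_dual_step\<close> along \<open>x (n - 1)\<close>, \<open>x n\<close>,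
  \<open>x (Suc n)\<close>; \<open>primal_coeff\<close> and \<open>dual_coeff\<close> allow two
  squares to be dropped. \<open>n > 1\<close> puts \<open>x (n - 1)\<close> in the domain of
  \<open>g\<close>.\<close>

lemma one_step:
  assumes n: "n > N" "n > 1"
  shows "2 * gap_term n + (1 - 1 / \<delta>) * increment n + \<delta> * lam n / lam (n - 1) * increment (n - 1)
      + (norm (x (Suc n) - xb))\<^sup>2 + 1 / \<beta> * (norm (y n - yb))\<^sup>2
    \<le> (norm (x n - xb))\<^sup>2 + 1 / \<beta> * (norm (y (n - 1) - yb))\<^sup>2"
proof -
  obtain m where m: "n = Suc m" "m > 0" using n by (cases n) auto
  \<comment> \<open>\<open>y n\<close> was computed with \<open>cur n\<close>, while
    \<open>x (Suc n)\<close> uses \<open>lam n\<close>; the bilinear terms combine because the two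
    agree.\<close>
  have cn: "cur n = lam n" using no_late_correction[OF n(1)] lam_uncorrected by simp
  have step: "2 * lam n * ((1 + \<delta>) * P (x n) - \<delta> * P (x m) + D (y n))
      + (1 - lam n / (\<delta> * lam m)) * (norm (x (Suc n) - x n))\<^sup>2 + \<delta> * lam n / lam m * (norm (x n - x m))\<^sup>2
      + (lam n / (\<delta> * lam m) - \<alpha> * lam n / (sqrt \<delta> * lam (Suc n))) * (norm (x (Suc n) - z n))\<^sup>2
      + 1 / \<beta> * (1 - \<alpha> * sqrt \<delta> * lam n / lam (Suc n)) * (norm (y n - y m))\<^sup>2
      + (norm (x (Suc n) - xb))\<^sup>2 + 1 / \<beta> * (norm (y n - yb))\<^sup>2
    \<le> (norm (x n - xb))\<^sup>2 + 1 / \<beta> * (norm (y m - yb))\<^sup>2"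
    unfolding P_def D_def
  proof (rule primal_dual_step[OF linear_K delta_pos beta alpha(1) lam_pos lam_pos lam_pos])
    show "z n = x n + \<delta> *\<^sub>R (x n - x m)" using z_Suc[of m] m by simp
    show "lam n * (real_of_ereal (g (x (Suc n))) - real_of_ereal (g xb))
      \<le> (x (Suc n) - (x n - lam n *\<^sub>R adjoint K (y n))) \<bullet> (xb - x (Suc n))"
      by (rule prox_inequality[OF g lam_pos x_Suc saddle_in_eff_dom(1)])
    show "lam m * (real_of_ereal (g (x n)) - real_of_ereal (g (x (Suc n))))
      \<le> (x n - (x m - lam m *\<^sub>R adjoint K (y m))) \<bullet> (x (Suc n) - x n)"
      unfolding m(1) by (rule prox_inequality[OF g lam_pos x_Suc x_in_eff_dom]) simp
    show "lam m * (real_of_ereal (g (x n)) - real_of_ereal (g (x m)))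
      \<le> (x n - (x m - lam m *\<^sub>R adjoint K (y m))) \<bullet> (x m - x n)"
      unfolding m(1) by (rule prox_inequality[OF g lam_pos x_Suc x_in_eff_dom]) (rule m)
    show "\<beta> * lam n * (real_of_ereal (conjugate f (y n)) - real_of_ereal (conjugate f yb))
      \<le> (y n - (y m + (\<beta> * lam n) *\<^sub>R K (z n))) \<bullet> (yb - y n)"
      using y_Suc[of m] m cn beta lam_pos[of n]
      by (intro prox_inequality[OF conjugate_f _ _ saddle_in_eff_dom(2)]) auto
    show "sqrt \<beta> * lam (Suc n) * norm (adjoint K (y n) - adjoint K (y m)) \<le> \<alpha> * norm (y n - y m)"
      unfolding m(1) by (rule lam_step_bound)
  qed
  \<comment> \<open>Decreasing step sizes let the coefficient of \<open>increment n\<close> be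
    lowered to a constant.\<close>
  have "lam n \<le> lam m" using decseq_lam m by (simp add: decseq_SucD)
  then have "lam n / (\<delta> * lam m) \<le> 1 / \<delta>"
    using lam_pos[of m] delta_pos by (simp add: field_simps)
  then have "(1 - 1 / \<delta>) * increment n \<le> (1 - lam n / (\<delta> * lam m)) * increment n"
    by (intro mult_right_mono) (auto simp: increment_def)
  moreover have "0 \<le> (lam n / (\<delta> * lam m) - \<alpha> * lam n / (sqrt \<delta> * lam (Suc n))) * (norm (x (Suc n) - z n))\<^sup>2"
    using primal_coeff[OF n(1)] m by simp
  moreover have "0 \<le> 1 / \<beta> * (1 - \<alpha> * sqrt \<delta> * lam n / lam (Suc n)) * (norm (y n - y m))\<^sup>2"
    using dual_coeff[OF n(1)] m beta by simp
  ultimately show ?thesis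
    using step by (simp add: m gap_term_def increment_def mult.assoc)
qed

text \<open>The negative multiple of \<open>increment n\<close> from step \<open>n\<close> is paired
  with the positive one from step \<open>Suc n\<close>, forming \<open>coeff n\<close>. Unpaired are
  the positive multiple of \<open>increment (m - 1)\<close>, discarded in the base case, and the
  negative one of \<open>increment j\<close>.\<close>

lemma telescoped:
  assumes "N < m" "1 < m" "m \<le> j"
  shows "2 * (\<Sum>n=m..j. gap_term n) + (\<Sum>n=m..<j. coeff n * increment n) + (1 - 1 / \<delta>) * increment j
      + (norm (x (Suc j) - xb))\<^sup>2 + 1 / \<beta> * (norm (y j - yb))\<^sup>2
    \<le> (norm (x m - xb))\<^sup>2 + 1 / \<beta> * (norm (y (m - 1) - yb))\<^sup>2"
  using assms(3)
proof (induction j rule: dec_induct)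
  case base
  have "0 \<le> \<delta> * lam m / lam (m - 1) * increment (m - 1)"
    using delta_pos lam_pos[of m] lam_pos[of "m - 1"] by (simp add: increment_def)
  then show ?case using one_step[OF assms(1,2)] by simp
next
  case (step j)
  have "N < Suc j" "1 < Suc j" using assms step by auto
  note one_step[OF this]
  moreover have "coeff j * increment j = (1 - 1 / \<delta>) * increment j + \<delta> * lam (Suc j) / lam j * increment j"
    by (simp add: coeff_def distrib_right)
  ultimately show ?case using step by (simp add: algebra_simps)
qed

text \<open>A single \<open>gap_term\<close> may be negative through \<open>P (x (n - 1))\<close>.
  Abel summation, closed at the lower end by the extra term, gives coefficients that are nonnegative
  by \<open>weight_nonneg\<close>.\<close>

lemma gap_sum:
  assumes "1 < m" "m \<le> j"
  shows "lam m * \<delta> * P (x (m - 1)) + (\<Sum>n=m..j. gap_term n) =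
    (\<Sum>n=m..j. ((1 + \<delta>) * lam n - (if n = j then 0 else \<delta> * lam (Suc n))) * P (x n))
    + (\<Sum>n=m..j. lam n * D (y n))"
proof -
  have "(\<Sum>n=m..j. gap_term n) = (\<Sum>n=m..j. lam n * (P (x n) + \<delta> * (P (x n) - P (x (n - 1))))) + (\<Sum>n=m..j. lam n * D (y n))"
    by (simp add: gap_term_def sum.distrib[symmetric] algebra_simps)
  then show ?thesis
    using extrapolated_sum[of m j lam \<delta> "\<lambda>n. P (x n)"] assms by simp
qed

lemma weight_nonneg: "0 \<le> (1 + \<delta>) * lam n - (if n = j then 0 else \<delta> * lam (Suc n))"
proof -
  have "\<delta> * lam (Suc n) \<le> \<delta> * lam n" using decseq_lam delta_pos by (simp add: decseq_SucD)
  moreover have "0 < \<delta> * lam n" using lam_pos[of n] delta_pos by simp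
  moreover have "(1 + \<delta>) * lam n = lam n + \<delta> * lam n" by (simp add: distrib_right)
  ultimately show ?thesis using lam_pos[of n] by (simp only: split: if_split) linarith
qed

lemma gap_sum_nonneg:
  assumes "1 < m" "m \<le> j"
  shows "0 \<le> lam m * \<delta> * P (x (m - 1)) + (\<Sum>n=m..j. gap_term n)"
  unfolding gap_sum[OF assms] using assms
  by (intro add_nonneg_nonneg sum_nonneg mult_nonneg_nonneg weight_nonneg P_nonneg D_nonneg
      x_in_eff_dom y_in_eff_dom less_imp_le[OF lam_pos]) auto

section \<open>Limits of the coefficients and of the increments\<close>

lemma coeff_pos: "n > N \<Longrightarrow> 0 < coeff n"
  using increment_coeff[of n] by (simp add: coeff_def)

text \<open>The lower bound on \<open>\<delta>\<close> is the positive root of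
  \<open>\<delta> * \<delta> + \<delta> - 1\<close>.\<close>

lemma golden_ratio_pos: "0 < 1 - 1 / \<delta> + \<delta>"
proof -
  have "sqrt 5 < 2 * \<delta> + 1" using delta by simp
  then have "(sqrt 5)\<^sup>2 < (2 * \<delta> + 1)\<^sup>2" by (intro power_strict_mono) auto
  then have "0 < \<delta> * \<delta> + \<delta> - 1" by (simp add: power2_eq_square algebra_simps)
  then show ?thesis using delta_pos by (simp add: field_simps)
qed

text \<open>A positive limit of \<open>lam\<close> forces the ratio of consecutive step sizes to
  tend to 1.\<close>

lemma coeff_limit: "coeff \<longlonglongrightarrow> 1 - 1 / \<delta> + \<delta>"
proof -
  obtain l where l: "l > 0" "lam \<longlonglongrightarrow> l" using lam_limit_pos[OF bl no_late_correction] by blast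
  have "coeff \<longlonglongrightarrow> 1 - 1 / \<delta> + \<delta> * l / l"
    unfolding coeff_def using l by (intro tendsto_intros LIMSEQ_Suc) auto
  then show ?thesis using l by simp
qed

text \<open>The summed estimate leaves \<open>(1/\<delta> - 1) * increment j\<close> on the right-hand side; only the bound enforced
  by Correction makes the partial sums bounded.\<close>

lemma increment_tendsto_0: "increment \<longlonglongrightarrow> 0"
proof -
  define m where "m = N + 2"
  have m: "N < m" "1 < m" by (auto simp: m_def)
  \<comment> \<open>The third summand compensates a possibly negative sum of gap terms; the last one
    majorises \<open>1 / \<delta> * increment j\<close>.\<close>
  define M where "M = (norm (x m - xb))\<^sup>2 + 1 / \<beta> * (norm (y (m - 1) - yb))\<^sup>2
      + 2 * (lam m * \<delta> * P (x (m - 1))) + 1 / \<delta> * (\<mu> * \<zeta> 0)\<^sup>2"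
  have le: "(\<Sum>n=m..<j. coeff n * increment n) \<le> M" if "m \<le> j" for j
  proof -
    have "increment j \<le> (\<mu> * \<zeta> 0)\<^sup>2"
      unfolding increment_def using increment_bounded[OF delta_lt_1] by (intro power_mono) auto
    then have "(1 / \<delta>) * increment j \<le> (1 / \<delta>) * (\<mu> * \<zeta> 0)\<^sup>2"
      using delta_pos by (intro mult_left_mono) auto
    moreover have "0 \<le> increment j" "0 \<le> (norm (x (Suc j) - xb))\<^sup>2" "0 \<le> 1 / \<beta> * (norm (y j - yb))\<^sup>2"
      using beta by (auto simp: increment_def)
    moreover have "(1 - 1 / \<delta>) * increment j = increment j - 1 / \<delta> * increment j"
      by (simp add: left_diff_distrib)
    ultimately show ?thesis
      using telescoped[OF m that] gap_sum_nonneg[OF m(2) that] unfolding M_def by linarith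
  qed
  have nn: "0 \<le> coeff (i + m) * increment (i + m)" for i
    using coeff_pos[of "i + m"] m by (simp add: increment_def)
  have "summable (\<lambda>i. coeff (i + m) * increment (i + m))"
  proof (rule bounded_imp_summable[where B = M])
    fix n
    have "(\<Sum>i\<le>n. coeff (i + m) * increment (i + m)) = (\<Sum>i=0..<Suc n. coeff (i + m) * increment (i + m))"
      by (rule sum.cong) auto
    also have "\<dots> = (\<Sum>i=0+m..<Suc n+m. coeff i * increment i)"
      by (rule sum.shift_bounds_nat_ivl[symmetric])
    finally show "(\<Sum>i\<le>n. coeff (i + m) * increment (i + m)) \<le> M" using le[of "Suc n + m"] by simp
  qed (rule nn)
  then have "(\<lambda>i. coeff (i + m) * increment (i + m)) \<longlonglongrightarrow> 0" by (rule summable_LIMSEQ_zero)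
  \<comment> \<open>The limit of the coefficients is positive, so dividing by them recovers the
    increments.\<close>
  then have "(\<lambda>i. coeff (i + m) * increment (i + m) / coeff (i + m)) \<longlonglongrightarrow> 0 / (1 - 1 / \<delta> + \<delta>)"
    using golden_ratio_pos by (intro tendsto_divide LIMSEQ_ignore_initial_segment[OF coeff_limit]) auto
  moreover have "coeff (i + m) \<noteq> 0" for i using coeff_pos[of "i + m"] m by simp
  ultimately have "(\<lambda>i. increment (i + m)) \<longlonglongrightarrow> 0" by simp
  then show ?thesis by (rule LIMSEQ_offset)
qed

text \<open>Either all increments vanish, or the right-hand side stays above a fixed positive number.\<close>

lemma eventually_last_increment_absorbed:
  assumes m: "N < m"
  shows "\<exists>J\<ge>m. \<forall>j>J. (1 / \<delta> - 1) * increment j \<le> (\<Sum>n=m..<j. coeff n * increment n)"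
proof (cases "\<forall>n\<ge>m. increment n = 0")
  case True
  then show ?thesis by (intro exI[of _ m]) auto
next
  case False
  then obtain i where i: "i \<ge> m" "increment i \<noteq> 0" by auto
  have nn: "0 \<le> coeff n * increment n" if "n \<ge> m" for n
    using coeff_pos[of n] m that by (simp add: increment_def)
  have pos: "0 < coeff i * increment i"
    using coeff_pos[of i] m i by (simp add: increment_def)
  have "(\<lambda>j. (1 / \<delta> - 1) * increment j) \<longlonglongrightarrow> (1 / \<delta> - 1) * 0"
    by (intro tendsto_intros increment_tendsto_0)
  then have "\<forall>\<^sub>F j in sequentially. (1 / \<delta> - 1) * increment j < coeff i * increment i"
    using pos by (intro order_tendstoD(2)) auto
  then obtain J where J: "\<And>j. j \<ge> J \<Longrightarrow> (1 / \<delta> - 1) * increment j < coeff i * increment i"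
    by (auto simp: eventually_sequentially)
  show ?thesis
  proof (intro exI[of _ "max i J"] conjI allI impI)
    fix j assume j: "j > max i J"
    have "(1 / \<delta> - 1) * increment j \<le> coeff i * increment i" using J[of j] j by simp
    also have "\<dots> \<le> (\<Sum>n=m..<j. coeff n * increment n)"
      using i j nn by (intro member_le_sum) auto
    finally show "(1 / \<delta> - 1) * increment j \<le> (\<Sum>n=m..<j. coeff n * increment n)" .
  qed (use i in auto)
qed

text \<open>Jensen's inequality at \<open>X\<close> with total weight
  \<open>lam m * \<delta> + s\<close> and at \<open>Y\<close> with total weight \<open>s\<close>,
  combined with \<open>gap_sum\<close> and \<open>telescoped\<close>. Absorption of the last
  increment is a hypothesis, so the estimate concerns a single \<open>j\<close>.\<close>

lemma ergodic_gap_bound: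
  assumes m: "N < m" "1 < m" and j: "m \<le> j"
    and s: "s = (\<Sum>l=m..j. lam l)"
    and X: "X = ((lam m * \<delta>) *\<^sub>R x (m - 1) + (\<Sum>l=m..j. lam l *\<^sub>R z l)) /\<^sub>R (lam m * \<delta> + s)"
    and Y: "Y = (\<Sum>l=m..j. lam l *\<^sub>R y l) /\<^sub>R s"
    and absorbed: "(1 / \<delta> - 1) * increment j \<le> (\<Sum>n=m..<j. coeff n * increment n)"
  shows "X \<in> eff_dom g" "Y \<in> eff_dom (conjugate f)"
    and "P X + D Y \<le> 1 / (2 * s) * ((norm (x m - xb))\<^sup>2 + 1 / \<beta> * (norm (y (m - 1) - yb))\<^sup>2
        + 2 * \<delta> * lam m * P (x (m - 1)))"
proof -
  define w where "w = (\<lambda>n. (1 + \<delta>) * lam n - (if n = j then 0 else \<delta> * lam (Suc n)))"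
  have s0: "s > 0" unfolding s using j lam_pos by (intro sum_pos) auto
  have W0: "lam m * \<delta> + s > 0" using s0 delta_pos lam_pos[of m] by (simp add: add_pos_pos)
  have Z: "lam l *\<^sub>R z l = lam l *\<^sub>R (x l + \<delta> *\<^sub>R (x l - x (l - 1)))" if "l \<in> {m..j}" for l
    using z_Suc[of "l - 1"] that m by simp
  have "(\<Sum>l=m..j. lam l *\<^sub>R z l) = (\<Sum>l=m..j. lam l *\<^sub>R (x l + \<delta> *\<^sub>R (x l - x (l - 1))))"
    by (rule sum.cong[OF refl Z])
  then have "(lam m * \<delta>) *\<^sub>R x (m - 1) + (\<Sum>l=m..j. lam l *\<^sub>R z l) = (\<Sum>n=m..j. w n *\<^sub>R x n)"
    unfolding w_def using extrapolated_sum[of m j lam \<delta> x] m j by simp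
  then have X': "X = (\<Sum>n=m..j. w n *\<^sub>R x n) /\<^sub>R (lam m * \<delta> + s)" by (simp add: X)
  \<comment> \<open>Abel summation of the constant 1 yields the normalising factor of
    \<open>X\<close>.\<close>
  have w1: "sum w {m..j} = lam m * \<delta> + s"
    unfolding w_def s using extrapolated_sum[of m j lam \<delta> "\<lambda>_. 1::real"] m j by simp
  have w0: "0 \<le> w n" for n unfolding w_def by (rule weight_nonneg)
  have xd: "x n \<in> eff_dom g" "y n \<in> eff_dom (conjugate f)" if "n \<in> {m..j}" for n
    using that m x_in_eff_dom y_in_eff_dom by auto
  show Xd: "X \<in> eff_dom g"
    unfolding X' by (rule convex_on_weighted_sum(1)[OF convex_on_P _ w0 w1 W0 xd(1)]) simp_all
  have PX: "(lam m * \<delta> + s) * P X \<le> (\<Sum>n=m..j. w n * P (x n))"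
    unfolding X' by (rule convex_on_weighted_sum(2)[OF convex_on_P _ w0 w1 W0 xd(1)]) simp_all
  show "Y \<in> eff_dom (conjugate f)"
    unfolding Y by (rule convex_on_weighted_sum(1)[OF convex_on_D _ _ s[symmetric] s0 xd(2)])
      (simp_all add: less_imp_le[OF lam_pos])
  have DY: "s * D Y \<le> (\<Sum>n=m..j. lam n * D (y n))"
    unfolding Y by (rule convex_on_weighted_sum(2)[OF convex_on_D _ _ s[symmetric] s0 xd(2)])
      (simp_all add: less_imp_le[OF lam_pos])
  \<comment> \<open>The surplus weight at \<open>X\<close> is discarded, which leaves the common
    factor \<open>s\<close>.\<close>
  have "0 \<le> lam m * \<delta> * P X" using lam_pos[of m] delta_pos P_nonneg[OF Xd] by simp
  then have "s * (P X + D Y) \<le> lam m * \<delta> * P (x (m - 1)) + (\<Sum>n=m..j. gap_term n)"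
    using PX DY gap_sum[OF m(2) j] by (simp add: w_def algebra_simps)
  moreover have "0 \<le> (norm (x (Suc j) - xb))\<^sup>2" "0 \<le> 1 / \<beta> * (norm (y j - yb))\<^sup>2"
    using beta by auto
  moreover have "(1 - 1 / \<delta>) * increment j = - ((1 / \<delta> - 1) * increment j)"
    by (simp add: algebra_simps)
  ultimately have "2 * (s * (P X + D Y)) \<le> (norm (x m - xb))\<^sup>2 + 1 / \<beta> * (norm (y (m - 1) - yb))\<^sup>2
        + 2 * (lam m * \<delta> * P (x (m - 1)))"
    using telescoped[OF m j] absorbed by linarith
  then show "P X + D Y \<le> 1 / (2 * s) * ((norm (x m - xb))\<^sup>2 + 1 / \<beta> * (norm (y (m - 1) - yb))\<^sup>2
        + 2 * \<delta> * lam m * P (x (m - 1)))"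
    using s0 by (simp add: field_simps)
qed

lemma eventually_gap_bound:
  assumes n1: "N < n1" "1 < n1"
    and s: "\<And>j. j > n1 \<Longrightarrow> s j = (\<Sum>l=n1..j. lam l)"
    and X: "\<And>j. j > n1 \<Longrightarrow> X j = ((lam n1 * \<delta>) *\<^sub>R x (n1 - 1) + (\<Sum>l=n1..j. lam l *\<^sub>R z l))
                                /\<^sub>R (lam n1 * \<delta> + s j)"
    and Y: "\<And>j. j > n1 \<Longrightarrow> Y j = (\<Sum>l=n1..j. lam l *\<^sub>R y l) /\<^sub>R s j"
  shows "\<exists>J\<ge>n1. \<forall>j>J. pd_gap f g K xb yb (X j) (Y j) \<le>
    ereal (1 / (2 * s j)) *
      (ereal ((norm (x n1 - xb))\<^sup>2 + 1 / \<beta> * (norm (y (n1 - 1) - yb))\<^sup>2)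
        + ereal (2 * \<delta> * lam n1) * primal_gap g K xb yb (x (n1 - 1)))"
proof -
  obtain J where J: "J \<ge> n1"
    "\<And>j. j > J \<Longrightarrow> (1 / \<delta> - 1) * increment j \<le> (\<Sum>n=n1..<j. coeff n * increment n)"
    using eventually_last_increment_absorbed[OF n1(1)] by blast
  show ?thesis
  proof (intro exI[of _ J] conjI allI impI)
    fix j assume "j > J"
    then have j: "j > n1" "n1 \<le> j" using J by auto
    note eb = ergodic_gap_bound[OF n1 j(2) s[OF j(1)] X[OF j(1)] Y[OF j(1)] J(2)[OF \<open>j > J\<close>]]
    have "x (n1 - 1) \<in> eff_dom g" using n1 by (intro x_in_eff_dom) simp
    then show "pd_gap f g K xb yb (X j) (Y j) \<le>
      ereal (1 / (2 * s j)) *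
      (ereal ((norm (x n1 - xb))\<^sup>2 + 1 / \<beta> * (norm (y (n1 - 1) - yb))\<^sup>2)
        + ereal (2 * \<delta> * lam n1) * primal_gap g K xb yb (x (n1 - 1)))"
      using eb by (simp add: pd_gap_def primal_gap_eq dual_gap_eq)
  qed (rule J(1))
qed

end

theorem theorem2:
  fixes f :: "'b::euclidean_space \<Rightarrow> ereal" and g :: "'a::euclidean_space \<Rightarrow> ereal"
    and K :: "'a \<Rightarrow> 'b"
    and \<delta> \<rho> \<nu> \<mu> \<beta> \<alpha> :: real
    and x z X :: "nat \<Rightarrow> 'a" and y Y :: "nat \<Rightarrow> 'b"
    and \<zeta> cur nxt lam s :: "nat \<Rightarrow> real" and k :: "nat \<Rightarrow> nat"
    and xb :: 'a and yb :: 'b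
    and N n1 :: nat
  assumes "proper_fun f" "lsc_fun f" "convex_fun f"
    and "proper_fun g" "lsc_fun g" "convex_fun g"
    and "bounded_linear K"
    and "(sqrt 5 - 1) / 2 < \<delta>" "\<delta> < 1"
    and "pda_c f g K \<delta> \<rho> \<nu> \<mu> \<beta> \<alpha> x y z \<zeta> cur nxt lam k"
    and "(xb, yb) \<in> saddle_points f g K"
    and "N > 2"
    and "\<And>n. n > N \<Longrightarrow> lam n / (\<delta> * lam (n - 1)) - \<alpha> * lam n / (sqrt \<delta> * lam (n + 1)) > 0"
    and "\<And>n. n > N \<Longrightarrow> 1 - \<alpha> * sqrt \<delta> * lam n / lam (n + 1) > 0"
    and "\<And>n. n > N \<Longrightarrow> 1 - 1 / \<delta> + \<delta> * lam (n + 1) / lam n > 0"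
    and no_late_correction: "\<And>n. n > N \<Longrightarrow> k n = 0"
    and "n1 > N"
    and "\<And>j. j > n1 \<Longrightarrow> s j = (\<Sum>l=n1..j. lam l)"
    and "\<And>j. j > n1 \<Longrightarrow> X j = ((lam n1 * \<delta>) *\<^sub>R x (n1 - 1) + (\<Sum>l=n1..j. lam l *\<^sub>R z l))
                                /\<^sub>R (lam n1 * \<delta> + s j)"
    and "\<And>j. j > n1 \<Longrightarrow> Y j = (\<Sum>l=n1..j. lam l *\<^sub>R y l) /\<^sub>R s j"
  shows "\<exists>J\<ge>n1. \<forall>j>J. pd_gap f g K xb yb (X j) (Y j) \<le>
    ereal (1 / (2 * s j)) *
      (ereal ((norm (x n1 - xb))\<^sup>2 + 1 / \<beta> * (norm (y (n1 - 1) - yb))\<^sup>2)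
        + ereal (2 * \<delta> * lam n1) * primal_gap g K xb yb (x (n1 - 1)))"
proof -
  have "pda_c_saddle f g K \<delta> \<rho> \<nu> \<mu> \<beta> \<alpha> x y z \<zeta> cur nxt lam k xb yb N"
    by (rule pda_c_saddle.intro, fact, rule pda_c_saddle_axioms.intro) fact+
  then show ?thesis
  proof (rule pda_c_saddle.eventually_gap_bound)
    \<comment> \<open>Hence \<open>x (n1 - 1)\<close> is itself a proximal point, and
      \<open>g\<close> is finite there.\<close>
    show "1 < n1" using assms by simp
  qed fact+
qed

end
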